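(* The critically finite endomorphism $$g:\mathbb{P}^2\to\mathbb{P}^2,\qquad [x:y:z]\mapsto[(x-2y)^2:(x-2z)^2:x^2]$$ is not a Lattès example.
   Context: A Galois covering of group $G$ is a (possibly ramified) finite holomorphic map which is the quotient map by a finite group $G$ of automorphisms of the source. A Lattès example of $\mathbb{P}^k$ is a holomorphic endomorphism $f$ of $\mathbb{P}^k$ of degree $d\ge2$ such that there exist a complex torus $A^k$ of dimension $k$, a holomorphic endomorphism $D$ of $A^k$ and a Galois covering $\sigma:A^k\to\mathbb{P}^k$ with $\sigma\circ D=f\circ\sigma$. A holomorphic endomorphism $f$ of $\mathbb{P}^k$ is critically finite if $\bigcup_{n\ge1}f^n(\mathcal{C}_f)$ is algebraic, where $\mathcal{C}_f$ is the critical set of $f$. *)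

theory Defs
  imports "HOL-Analysis.Analysis" "HOL-Algebra.Bij"
begin

definition holomorphic_vec_on ::
    "(complex^'m \<Rightarrow> complex^'n) \<Rightarrow> (complex^'m) set \<Rightarrow> bool" where
  "holomorphic_vec_on F S \<longleftrightarrow>
     (\<forall>u\<in>S. \<exists>F'. (F has_derivative F') (at u) \<and> (\<forall>c v. F' (c *s v) = c *s F' v))"

text \<open>
  An atlas is recorded by the inverses of its charts: a pair \<open>(W, p)\<close> consists of an open set
  \<open>W\<close> of \<open>\<complex>\<^sup>k\<close> and a map \<open>p\<close> that is injective on \<open>W\<close>, whose inverse \<open>p ` W \<rightarrow> W\<close> is a chart.
  The manifold carries the topology induced by its charts.
\<close>

type_synonym ('k, 'a) atlas = "((complex^'k) set \<times> (complex^'k \<Rightarrow> 'a)) set"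

definition points :: "('k::finite, 'a) atlas \<Rightarrow> 'a set" where
  "points M = (\<Union>(W, p)\<in>M. p ` W)"

text \<open>\<open>F\<close> is a holomorphic expression of \<open>f\<close> on \<open>S\<close> in the chart \<open>p\<^sup>-\<^sup>1\<close> of the source and some
  chart \<open>q\<^sup>-\<^sup>1\<close> of the target, i.e. \<open>F = q\<^sup>-\<^sup>1 \<circ> f \<circ> p\<close> on \<open>S\<close>.\<close>

definition local_expression ::
    "('m::finite, 'a) atlas \<Rightarrow> ('n::finite, 'b) atlas \<Rightarrow> ('a \<Rightarrow> 'b) \<Rightarrow>
     (complex^'m \<Rightarrow> 'a) \<Rightarrow> (complex^'m) set \<Rightarrow> (complex^'m \<Rightarrow> complex^'n) \<Rightarrow> bool" where
  "local_expression M N f p S F \<longleftrightarrow>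
     (\<exists>W V q. (W, p) \<in> M \<and> (V, q) \<in> N \<and> open S \<and> S \<subseteq> W \<and> F ` S \<subseteq> V \<and>
        (\<forall>u\<in>S. f (p u) = q (F u)) \<and> holomorphic_vec_on F S)"

definition holomorphic_map ::
    "('m::finite, 'a) atlas \<Rightarrow> ('n::finite, 'b) atlas \<Rightarrow> ('a \<Rightarrow> 'b) \<Rightarrow> bool" where
  "holomorphic_map M N f \<longleftrightarrow>
     (\<forall>x\<in>points M. \<exists>p S F. local_expression M N f p S F \<and> x \<in> p ` S)"

definition critical_set :: "('k::finite, 'a) atlas \<Rightarrow> ('a \<Rightarrow> 'a) \<Rightarrow> 'a set" where
  "critical_set M f =
     {p u | p S F u. local_expression M M f p S F \<and> u \<in> S \<and>
        (\<exists>F'. (F has_derivative F') (at u) \<and> \<not> bij F')}"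

text \<open>The group \<open>G\<close> is closed under inverses, so its members are biholomorphic.  The target
  is the quotient by \<open>G\<close>: the map is onto and its fibres are the \<open>G\<close>-orbits.\<close>

definition galois_covering ::
    "('m::finite, 'a) atlas \<Rightarrow> ('n::finite, 'b) atlas \<Rightarrow> ('a \<Rightarrow> 'b) \<Rightarrow> bool" where
  "galois_covering M N \<sigma> \<longleftrightarrow>
     holomorphic_map M N \<sigma> \<and> \<sigma> ` points M = points N \<and>
     (\<exists>G. finite G \<and> subgroup G (BijGroup (points M)) \<and> (\<forall>h\<in>G. holomorphic_map M M h) \<and>
        (\<forall>a\<in>points M. \<forall>b\<in>points M. \<sigma> a = \<sigma> b \<longleftrightarrow> (\<exists>h\<in>G. b = h a)))"

text \<open>\<open>independent\<close> and \<open>span\<close> are over the reals, so \<open>B\<close> is a real basis of \<open>\<complex>\<^sup>k\<close>.\<close>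

definition is_lattice :: "(complex^'k) set \<Rightarrow> bool" where
  "is_lattice \<Lambda> \<longleftrightarrow>
     (\<exists>B. independent B \<and> span B = UNIV \<and>
        \<Lambda> = range (\<lambda>n. \<Sum>b\<in>B. real_of_int (n b) *\<^sub>R b))"

definition coset :: "(complex^'k) set \<Rightarrow> complex^'k \<Rightarrow> (complex^'k) set" where
  "coset \<Lambda> z = (+) z ` \<Lambda>"

definition complex_torus :: "(complex^'k) set \<Rightarrow> ('k::finite, (complex^'k) set) atlas" where
  "complex_torus \<Lambda> = {(W, coset \<Lambda>) | W. open W \<and> inj_on (coset \<Lambda>) W}"

definition proportional :: "complex^'n \<Rightarrow> complex^'n \<Rightarrow> bool" where
  "proportional v w \<longleftrightarrow> v \<noteq> 0 \<and> (\<exists>c. c \<noteq> 0 \<and> w = c *s v)"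

lemma proportional_part_equivp: "part_equivp (proportional :: complex^'n \<Rightarrow> complex^'n \<Rightarrow> bool)"
proof (rule part_equivpI)
  show "\<exists>v :: complex^'n. proportional v v"
    by (rule exI[of _ "\<chi> i. 1"])
       (auto simp: proportional_def vec_eq_iff intro!: exI[of _ 1])
  show "symp (proportional :: complex^'n \<Rightarrow> complex^'n \<Rightarrow> bool)"
  proof (rule sympI)
    fix v w :: "complex^'n"
    assume "proportional v w"
    then obtain c where "v \<noteq> 0" "c \<noteq> 0" "w = c *s v"
      by (auto simp: proportional_def)
    then show "proportional w v"
      by (auto simp: proportional_def vector_smult_assoc intro!: exI[of _ "inverse c"])
  qed
  show "transp (proportional :: complex^'n \<Rightarrow> complex^'n \<Rightarrow> bool)"
  proof (rule transpI)
    fix u v w :: "complex^'n"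
    assume "proportional u v" "proportional v w"
    then obtain c d where "u \<noteq> 0" "c \<noteq> 0" "d \<noteq> 0" "v = c *s u" "w = d *s v"
      by (auto simp: proportional_def)
    then show "proportional u w"
      by (auto simp: proportional_def vector_smult_assoc intro!: exI[of _ "d * c"])
  qed
qed

text \<open>\<open>'k cproj\<close> is \<open>\<bbbP>\<^sup>k\<close> for \<open>k = CARD('k)\<close>.  The \<open>k + 1\<close> homogeneous coordinates are indexed by
  \<open>'k option\<close>.  Only the values \<open>cproj v\<close> with \<open>v \<noteq> 0\<close> are meaningful.\<close>

quotient_type 'k cproj = "complex^('k::finite option)" / partial: proportional
  morphisms rep_cproj cproj
  by (rule proportional_part_equivp)

text \<open>The affine charts \<open>{v\<^sub>i \<noteq> 0}\<close>; \<open>e\<close> enumerates the remaining \<open>k\<close> homogeneous coordinates,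
  and all enumerations are admitted.\<close>

definition cproj_space :: "('k::finite, 'k cproj) atlas" where
  "cproj_space =
     {(UNIV, \<lambda>u. cproj (\<chi> j. if j = i then 1 else u $ inv_into UNIV e j)) | i e.
        bij_betw e UNIV (- {i})}"

definition homogeneous_poly :: "nat \<Rightarrow> (complex^'n \<Rightarrow> complex) \<Rightarrow> bool" where
  "homogeneous_poly d P \<longleftrightarrow>
     (\<exists>c. P = (\<lambda>v. \<Sum>\<alpha> | (\<Sum>i\<in>UNIV. \<alpha> i) = d. c \<alpha> * (\<Prod>i\<in>UNIV. v $ i ^ \<alpha> i)))"

definition algebraic_set :: "('k::finite) cproj set \<Rightarrow> bool" where
  "algebraic_set X \<longleftrightarrow>
     (\<exists>Ps. finite Ps \<and> (\<forall>P\<in>Ps. \<exists>d. homogeneous_poly d P) \<and>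
        X = {cproj v | v. v \<noteq> 0 \<and> (\<forall>P\<in>Ps. P v = 0)})"

text \<open>The algebraic degree, i.e. the common degree of the components of a homogeneous
  polynomial lift without common zeros (the topological degree is its \<open>k\<close>-th power).\<close>

definition has_degree :: "('k::finite cproj \<Rightarrow> 'k cproj) \<Rightarrow> nat \<Rightarrow> bool" where
  "has_degree f d \<longleftrightarrow>
     (\<exists>F. (\<forall>i. homogeneous_poly d (\<lambda>v. F v $ i)) \<and>
        (\<forall>v. v \<noteq> 0 \<longrightarrow> F v \<noteq> 0 \<and> f (cproj v) = cproj (F v)))"

definition critically_finite :: "('k::finite cproj \<Rightarrow> 'k cproj) \<Rightarrow> bool" where
  "critically_finite f \<longleftrightarrow>
     holomorphic_map cproj_space cproj_space f \<and>
     algebraic_set (\<Union>n\<in>{1..}. (f ^^ n) ` critical_set cproj_space f)"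

definition lattes_example :: "('k::finite cproj \<Rightarrow> 'k cproj) \<Rightarrow> bool" where
  "lattes_example f \<longleftrightarrow>
     holomorphic_map cproj_space cproj_space f \<and> (\<exists>d\<ge>2. has_degree f d) \<and>
     (\<exists>(\<Lambda> :: (complex^'k) set) D \<sigma>. is_lattice \<Lambda> \<and>
        holomorphic_map (complex_torus \<Lambda>) (complex_torus \<Lambda>) D \<and>
        galois_covering (complex_torus \<Lambda>) cproj_space \<sigma> \<and>
        (\<forall>a\<in>points (complex_torus \<Lambda>). \<sigma> (D a) = f (\<sigma> a)))"

text \<open>In the index type \<open>2\<close> one has \<open>2 = 0 \<noteq> 1\<close>.\<close>

definition triple :: "complex \<Rightarrow> complex \<Rightarrow> complex \<Rightarrow> complex^(2 option)" where
  "triple x y z = (\<chi> i. case i of None \<Rightarrow> x | Some j \<Rightarrow> if j = 1 then y else z)"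

lemma triple_nth [simp]:
  "triple x y z $ None = x" "triple x y z $ Some 1 = y" "triple x y z $ Some 2 = z"
  by (simp_all add: triple_def)

lemma triple_eq_iff [simp]:
  "triple x y z = triple x' y' z' \<longleftrightarrow> x = x' \<and> y = y' \<and> z = z'"
  by (metis triple_nth)

lemma triple_eq: "triple (v $ None) (v $ Some 1) (v $ Some 2) = v"
  unfolding vec_eq_iff
proof
  fix i :: "2 option"
  show "triple (v $ None) (v $ Some 1) (v $ Some 2) $ i = v $ i"
  proof (cases i)
    case (Some j)
    then show ?thesis using exhaust_2[of j] by auto
  qed simp
qed

lemma triple_eq_0_iff [simp]: "triple x y z = 0 \<longleftrightarrow> x = 0 \<and> y = 0 \<and> z = 0"
  by (metis triple_eq triple_eq_iff zero_index)

lemma scale_triple [simp]: "c *s triple x y z = triple (c * x) (c * y) (c * z)"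
  using triple_eq[of "c *s triple x y z"] by simp

definition hpoint :: "complex \<Rightarrow> complex \<Rightarrow> complex \<Rightarrow> 2 cproj" (\<open>'[_ : _ : _']\<close>) where
  "[x : y : z] = cproj (triple x y z)"

lift_definition g :: "2 cproj \<Rightarrow> 2 cproj" is
  "\<lambda>v. let x = v $ None; y = v $ Some 1; z = v $ Some 2
        in triple ((x - 2 * y)\<^sup>2) ((x - 2 * z)\<^sup>2) (x\<^sup>2)"
proof -
  fix v w :: "complex^(2 option)"
  assume "proportional v w"
  then obtain c where v: "v \<noteq> 0" and c: "c \<noteq> 0" "w = c *s v"
    by (auto simp: proportional_def)
  obtain x y z where vt: "v = triple x y z"
    by (metis triple_eq)
  show "proportional
      (let x = v $ None; y = v $ Some 1; z = v $ Some 2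
       in triple ((x - 2 * y)\<^sup>2) ((x - 2 * z)\<^sup>2) (x\<^sup>2))
      (let x = w $ None; y = w $ Some 1; z = w $ Some 2
       in triple ((x - 2 * y)\<^sup>2) ((x - 2 * z)\<^sup>2) (x\<^sup>2))"
    using v c unfolding proportional_def Let_def vt
    by (auto intro!: exI[of _ "c\<^sup>2"] simp: power2_eq_square algebra_simps)
qed

lemma g_hpoint:
  assumes "(x, y, z) \<noteq> (0, 0, 0)"
  shows "g [x : y : z] = [(x - 2 * y)\<^sup>2 : (x - 2 * z)\<^sup>2 : x\<^sup>2]"
proof -
  have "proportional (triple x y z) (triple x y z)"
    using assms by (auto simp: proportional_def intro!: exI[of _ 1])
  then show ?thesis
    unfolding hpoint_def by (simp add: g.abs_eq)
qed

end

theory Submission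
  imports Defs "HOL-Complex_Analysis.Cauchy_Integral_Formula"
begin

text \<open>
  Critical finiteness.  The critical lines \<open>x = 0\<close>, \<open>x = 2y\<close>, \<open>x = 2z\<close> are mapped to \<open>z = 0\<close>,
  \<open>x = 0\<close>, \<open>y = 0\<close>.  Moreover \<open>z = 0\<close> goes to \<open>y = z\<close>, \<open>y = 0\<close> goes to \<open>x = z\<close>, and \<open>g\<close> permutes
  \<open>y = z\<close>, \<open>x = y\<close>, \<open>x = z\<close> cyclically.  So the postcritical set is the union of six lines.

  No Lattes example.  The classical reason is that the branch locus of \<open>\<sigma>\<close> would be too large: the
  branching weight along a critical orbit makes \<open>\<sigma>\<close> branch over \<open>x = y\<close>, whose preimage contains the
  line \<open>x = y + z\<close>, which is neither critical nor postcritical.  Then \<open>\<sigma>\<close> branches over this line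
  and over all its iterated preimages, none of which is critical.  The proof below carries this out
  for single points, upstairs on \<open>\<complex>\<^sup>2\<close>.

  Compose \<open>\<sigma>\<close> with the projection of \<open>\<complex>\<^sup>2\<close> to a \<open>\<Lambda>\<close>-periodic map \<open>s\<close> onto the projective plane.
  By Liouville's theorem a holomorphic self-map of the torus lifts to an affine map
  (\<open>torus_map_affine\<close>).  As the fibres of \<open>\<sigma>\<close> are orbits of a finite group of such maps, one obtains for
  all \<open>u\<close>, \<open>v\<close> with \<open>s v = g (s u)\<close> an affine map that sends \<open>u\<close> to \<open>v\<close> and that \<open>s\<close> semiconjugates to
  \<open>g\<close> (locale \<open>toral_semiconjugacy\<close>).

  The point \<open>[1:1:1]\<close> is fixed, with multipliers \<open>4\<omega>\<close> and \<open>4\<omega>\<^sup>2\<close> for a primitive cube root \<open>\<omega>\<close> of unity,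
  hence repelling.  Choose \<open>D z = A z + c\<close> fixing a point over it.  All eigenvalues of \<open>A\<close> have
  modulus above 1, since otherwise \<open>s\<close> would be constant on a disc in a complex line, against the countability
  of its fibres (\<open>expanding_at_fixed_point\<close>).

  Call \<open>u\<close> degenerate if the derivative of \<open>s\<close> at \<open>u\<close> is not injective.  By the chain rule \<open>D u\<close> is
  degenerate iff \<open>u\<close> is degenerate or \<open>s u\<close> is critical (\<open>degenerate_semiconjugacy\<close>).  Following a
  critical point into the line \<open>x = y\<close> and pulling back to the point \<open>[4:1:3]\<close> of \<open>x = y + z\<close> gives a
  degenerate point over \<open>[4:1:3]\<close> (\<open>degenerate_over_413\<close>).  As \<open>[4:1:3]\<close> is not postcritical, all
  preimages of this point and of its \<open>\<Lambda>\<close>-translates under all iterates of \<open>D\<close> are degenerate; they are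
  dense because \<open>D\<close> is expanding.  The degenerate points form a closed set, so every point is
  degenerate, which contradicts Sard's theorem because \<open>s\<close> is onto.
\<close>

section \<open>Holomorphic maps of several variables\<close>

abbreviation complex_linear :: "(complex^'m \<Rightarrow> complex^'n) \<Rightarrow> bool" where
  "complex_linear \<equiv> Vector_Spaces.linear (*s) (*s)"

abbreviation differential :: "(complex^'m \<Rightarrow> complex^'n) \<Rightarrow> complex^'m \<Rightarrow> complex^'m \<Rightarrow> complex^'n" where
  "differential F u \<equiv> frechet_derivative F (at u)"

lemma complex_linearI:
  assumes "\<And>v w. A (v + w) = A v + A w" "\<And>c v. A (c *s v) = c *s A v"
  shows "complex_linear A"
  using assms by unfold_locales (auto simp: vec.scale_right_distrib vec.scale_left_distrib)

lemma complex_linear_add: "complex_linear A \<Longrightarrow> A (v + w) = A v + A w"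
  and complex_linear_diff: "complex_linear A \<Longrightarrow> A (v - w) = A v - A w"
  and complex_linear_scale: "complex_linear A \<Longrightarrow> A (c *s v) = c *s A v"
  and complex_linear_0: "complex_linear A \<Longrightarrow> A 0 = 0"
  by (simp_all add: Vector_Spaces.linear.axioms vec.linear_add vec.linear_diff vec.linear_scale vec.linear_0)

lemma scaleR_conv_scale: "r *\<^sub>R v = complex_of_real r *s v" for v :: "complex^'n"
  by (simp add: vec_eq_iff scaleR_conv_of_real[where 'a = complex])

lemma norm_scale: "norm (c *s v) = cmod c * norm v" for v :: "complex^'n"
  by (simp add: norm_vec_def norm_mult L2_set_right_distrib)

lemma complex_linear_imp_linear: "complex_linear A \<Longrightarrow> linear A"
  by (rule linearI) (simp_all add: complex_linear_add complex_linear_scale scaleR_conv_scale)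

lemma complex_linear_imp_bounded_linear:
  "complex_linear A \<Longrightarrow> bounded_linear A" for A :: "complex^'m \<Rightarrow> complex^'n"
  using complex_linear_imp_linear linear_conv_bounded_linear by blast

lemma vec2_eq_axis: "w = (w $ 1) *s axis 1 1 + (w $ 2) *s axis 2 1" for w :: "complex^2"
  by (simp add: vec_eq_iff forall_2 axis_def)

lemma complex_linear_on_axes:
  fixes w :: "complex^2"
  assumes "complex_linear A"
  shows "A w = (w $ 1) *s A (axis 1 1) + (w $ 2) *s A (axis 2 1)"
  by (subst vec2_eq_axis[of w]) (simp only: complex_linear_add[OF assms] complex_linear_scale[OF assms])

lemma has_derivative_vecI:
  fixes f :: "'a::euclidean_space \<Rightarrow> complex^'n"
  assumes "\<And>i. ((\<lambda>x. f x $ i) has_derivative (\<lambda>h. f' h $ i)) (at u within S)"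
  shows "(f has_derivative f') (at u within S)"
  unfolding has_derivative_componentwise_within[of f]
proof
  fix b :: "complex^'n" assume "b \<in> Basis"
  then obtain i c where b: "b = axis i c" by (auto simp: Basis_vec_def)
  show "((\<lambda>x. f x \<bullet> b) has_derivative (\<lambda>x. f' x \<bullet> b)) (at u within S)"
    using bounded_linear.has_derivative[OF bounded_linear_inner_left[of c] assms[of i]]
    by (simp add: b inner_axis)
qed

lemma has_derivative_vec_nth:
  "(f has_derivative f') F \<Longrightarrow> ((\<lambda>x. f x $ i) has_derivative (\<lambda>h. f' h $ i)) F"
  for f :: "'a::real_normed_vector \<Rightarrow> complex^'n"
  by (rule bounded_linear.has_derivative[OF bounded_linear_vec_nth])

lemma holomorphic_vec_on_differential:
  assumes "holomorphic_vec_on F S" "u \<in> S"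
  shows "(F has_derivative differential F u) (at u)" "complex_linear (differential F u)"
proof -
  obtain F' where F': "(F has_derivative F') (at u)" "\<And>c v. F' (c *s v) = c *s F' v"
    using assms unfolding holomorphic_vec_on_def by blast
  have eq: "differential F u = F'"
    using frechet_derivative_at[OF F'(1)] by simp
  show "(F has_derivative differential F u) (at u)" using F' eq by simp
  show "complex_linear (differential F u)"
    unfolding eq by (intro complex_linearI F'(2)) (metis F'(1) has_derivative_linear linear_add)
qed

lemma holomorphic_vec_on_subset: "holomorphic_vec_on F S \<Longrightarrow> T \<subseteq> S \<Longrightarrow> holomorphic_vec_on F T"
  unfolding holomorphic_vec_on_def by blast

lemma holomorphic_vec_on_continuous: "holomorphic_vec_on F S \<Longrightarrow> continuous_on S F"
  unfolding holomorphic_vec_on_def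
  by (meson continuous_at_imp_continuous_on has_derivative_continuous)

lemma holomorphic_vec_onI:
  assumes "\<And>u. u \<in> S \<Longrightarrow> (F has_derivative F' u) (at u)" "\<And>u. u \<in> S \<Longrightarrow> complex_linear (F' u)"
  shows "holomorphic_vec_on F S"
  unfolding holomorphic_vec_on_def using assms complex_linear_scale by blast

lemma holomorphic_vec_on_affine:
  assumes "complex_linear A" shows "holomorphic_vec_on (\<lambda>v. A v + c) S"
  by (rule holomorphic_vec_onI[where F' = "\<lambda>_. A"])
     (auto intro!: derivative_eq_intros bounded_linear_imp_has_derivative
        complex_linear_imp_bounded_linear assms)

lemma holomorphic_vec_on_compose:
  assumes "holomorphic_vec_on F S" "holomorphic_vec_on H T" "F ` S \<subseteq> T"
  shows "holomorphic_vec_on (\<lambda>u. H (F u)) S"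
  unfolding holomorphic_vec_on_def
proof
  fix u assume u: "u \<in> S"
  obtain F' where F': "(F has_derivative F') (at u)" "\<And>c v. F' (c *s v) = c *s F' v"
    using assms(1) u unfolding holomorphic_vec_on_def by blast
  obtain H' where H': "(H has_derivative H') (at (F u))" "\<And>c v. H' (c *s v) = c *s H' v"
    using assms(2,3) u unfolding holomorphic_vec_on_def by blast
  show "\<exists>F'. ((\<lambda>u. H (F u)) has_derivative F') (at u) \<and> (\<forall>c v. F' (c *s v) = c *s F' v)"
    using has_derivative_compose[OF F'(1) H'(1)] F'(2) H'(2)
    by (intro exI[of _ "\<lambda>x. H' (F' x)"]) auto
qed

text \<open>The scalar version, at a point, so that quotients can be treated where the denominator does not vanish.\<close>

definition holomorphic_fun_at :: "(complex^'m \<Rightarrow> complex) \<Rightarrow> complex^'m \<Rightarrow> bool" where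
  "holomorphic_fun_at f u \<longleftrightarrow>
     (\<exists>f'. (f has_derivative f') (at u) \<and> (\<forall>c v. f' (c *s v) = c * f' v))"

lemma holomorphic_vec_on_componentwise:
  "holomorphic_vec_on F S \<longleftrightarrow> (\<forall>u\<in>S. \<forall>i. holomorphic_fun_at (\<lambda>v. F v $ i) u)"
proof (intro iffI ballI allI)
  fix u i assume "holomorphic_vec_on F S" "u \<in> S"
  then obtain F' where F': "(F has_derivative F') (at u)" "\<And>c v. F' (c *s v) = c *s F' v"
    unfolding holomorphic_vec_on_def by blast
  then show "holomorphic_fun_at (\<lambda>v. F v $ i) u"
    unfolding holomorphic_fun_at_def
    by (intro exI[of _ "\<lambda>h. F' h $ i"] conjI has_derivative_vec_nth) auto
next
  assume *: "\<forall>u\<in>S. \<forall>i. holomorphic_fun_at (\<lambda>v. F v $ i) u"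
  show "holomorphic_vec_on F S"
    unfolding holomorphic_vec_on_def
  proof
    fix u assume u: "u \<in> S"
    from * u obtain f' where f': "\<And>i. ((\<lambda>v. F v $ i) has_derivative f' i) (at u)"
        "\<And>i c v. f' i (c *s v) = c * f' i v"
      unfolding holomorphic_fun_at_def by metis
    show "\<exists>F'. (F has_derivative F') (at u) \<and> (\<forall>c v. F' (c *s v) = c *s F' v)"
    proof (intro exI[of _ "\<lambda>h. \<chi> i. f' i h"] conjI allI)
      show "(F has_derivative (\<lambda>h. \<chi> i. f' i h)) (at u)"
        by (rule has_derivative_vecI) (simp add: f'(1))
    qed (simp add: vec_eq_iff f'(2))
  qed
qed

lemma holomorphic_fun_at_const: "holomorphic_fun_at (\<lambda>v. c) u"
  unfolding holomorphic_fun_at_def by (intro exI[of _ "\<lambda>_. 0"]) auto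

lemma holomorphic_fun_at_add:
  assumes "holomorphic_fun_at f u" "holomorphic_fun_at h u"
  shows "holomorphic_fun_at (\<lambda>v. f v + h v) u"
proof -
  from assms obtain f' h' where "(f has_derivative f') (at u)" "\<forall>c v. f' (c *s v) = c * f' v"
    "(h has_derivative h') (at u)" "\<forall>c v. h' (c *s v) = c * h' v"
    unfolding holomorphic_fun_at_def by blast
  then show ?thesis unfolding holomorphic_fun_at_def
    by (intro exI[of _ "\<lambda>x. f' x + h' x"]) (auto intro!: derivative_eq_intros simp: algebra_simps)
qed

lemma holomorphic_fun_at_mult:
  assumes "holomorphic_fun_at f u" "holomorphic_fun_at h u"
  shows "holomorphic_fun_at (\<lambda>v. f v * h v) u"
proof -
  from assms obtain f' h' where "(f has_derivative f') (at u)" "\<forall>c v. f' (c *s v) = c * f' v"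
    "(h has_derivative h') (at u)" "\<forall>c v. h' (c *s v) = c * h' v"
    unfolding holomorphic_fun_at_def by blast
  then show ?thesis unfolding holomorphic_fun_at_def
    by (intro exI[of _ "\<lambda>x. f u * h' x + f' x * h u"]) (auto intro!: derivative_eq_intros simp: algebra_simps)
qed

lemma holomorphic_fun_at_diff:
  assumes "holomorphic_fun_at f u" "holomorphic_fun_at h u"
  shows "holomorphic_fun_at (\<lambda>v. f v - h v) u"
  using holomorphic_fun_at_add[OF assms(1) holomorphic_fun_at_mult[OF holomorphic_fun_at_const[of "-1"] assms(2)]]
  by simp

lemma holomorphic_fun_at_power:
  "holomorphic_fun_at f u \<Longrightarrow> holomorphic_fun_at (\<lambda>v. f v ^ n) u"
  by (induction n) (auto intro: holomorphic_fun_at_const holomorphic_fun_at_mult)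

lemma holomorphic_fun_at_divide:
  assumes "holomorphic_fun_at f u" "holomorphic_fun_at h u" "h u \<noteq> 0"
  shows "holomorphic_fun_at (\<lambda>v. f v / h v) u"
proof -
  from assms obtain h' where h': "(h has_derivative h') (at u)" "\<forall>c v. h' (c *s v) = c * h' v"
    unfolding holomorphic_fun_at_def by blast
  then have "holomorphic_fun_at (\<lambda>v. inverse (h v)) u"
    unfolding holomorphic_fun_at_def using assms(3)
    by (intro exI[of _ "\<lambda>x. - (inverse (h u) * h' x * inverse (h u))"])
       (auto intro!: derivative_eq_intros)
  from holomorphic_fun_at_mult[OF assms(1) this] show ?thesis by (simp add: field_class.field_divide_inverse)
qed

lemma holomorphic_fun_at_nth:
  assumes "holomorphic_vec_on F S" "u \<in> S" shows "holomorphic_fun_at (\<lambda>v. F v $ i) u"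
  using assms holomorphic_vec_on_componentwise by blast

lemma holomorphic_fun_at_coordinate: "holomorphic_fun_at (\<lambda>v. v $ i) u"
  using holomorphic_fun_at_nth[OF holomorphic_vec_on_affine[OF vec.linear_id, of 0 UNIV]] by simp

lemmas holomorphic_fun_at_intros = holomorphic_fun_at_const holomorphic_fun_at_add
  holomorphic_fun_at_diff holomorphic_fun_at_mult holomorphic_fun_at_power
  holomorphic_fun_at_coordinate

section \<open>Restriction to complex lines and continuity of the differential\<close>

lemma has_field_derivative_along_line:
  assumes "holomorphic_vec_on F S" "u + t *s w \<in> S"
  shows "((\<lambda>t. F (u + t *s w) $ i) has_field_derivative differential F (u + t *s w) w $ i) (at t)"
proof -
  let ?D = "differential F (u + t *s w)"
  have 1: "((\<lambda>t. u + t *s w) has_derivative (\<lambda>h. h *s w)) (at t)"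
    by (rule has_derivative_vecI) (auto intro!: derivative_eq_intros)
  have 2: "((\<lambda>t. F (u + t *s w) $ i) has_derivative (\<lambda>h. ?D (h *s w) $ i)) (at t)"
    by (rule has_derivative_vec_nth,
        rule has_derivative_compose[OF 1 holomorphic_vec_on_differential(1)[OF assms]])
  have "(\<lambda>h. ?D (h *s w) $ i) = (*) (?D w $ i)"
    by (auto simp: fun_eq_iff mult.commute
        complex_linear_scale[OF holomorphic_vec_on_differential(2)[OF assms]])
  with 2 show ?thesis
    unfolding has_field_derivative_def by simp
qed

text \<open>Cauchy's inequality for the difference of the two maps, restricted to complex lines in
  direction \<open>w\<close>.\<close>

lemma differential_difference_bound:
  fixes F H :: "complex^'m \<Rightarrow> complex^'n"
  assumes F: "holomorphic_vec_on F (ball u r)" and H: "holomorphic_vec_on H (ball v r)"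
    and r: "0 < r" "0 < \<rho>" "\<rho> * norm w < r"
    and B: "\<And>h. norm h < r \<Longrightarrow> norm (F (u + h) - H (v + h)) \<le> B"
  shows "cmod (differential F u w $ i - differential H v w $ i) \<le> B / \<rho>"
proof -
  define f where "f t = F (u + t *s w) $ i - H (v + t *s w) $ i" for t
  have small: "norm (t *s w) < r" if "t \<in> cball 0 \<rho>" for t
  proof -
    have "norm t * norm w \<le> \<rho> * norm w" using that by (intro mult_right_mono) auto
    with r show ?thesis by (simp add: norm_scale)
  qed
  have der: "(f has_field_derivative differential F (u + t *s w) w $ i - differential H (v + t *s w) w $ i) (at t)"
    if "t \<in> cball 0 \<rho>" for t
    unfolding f_def using small[OF that]
    by (intro DERIV_diff has_field_derivative_along_line[OF F] has_field_derivative_along_line[OF H])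
       (auto simp: dist_norm)
  have "norm ((deriv ^^ 1) f 0) \<le> fact 1 * B / \<rho> ^ 1"
  proof (rule Cauchy_inequality)
    show "f holomorphic_on ball 0 \<rho>"
      unfolding holomorphic_on_def
    proof
      fix t :: complex assume "t \<in> ball 0 \<rho>"
      then have "f field_differentiable at t"
        using der[of t] unfolding field_differentiable_def by (meson ball_subset_cball subsetD)
      then show "f field_differentiable at t within ball 0 \<rho>"
        by (rule field_differentiable_at_within)
    qed
    show "continuous_on (cball 0 \<rho>) f"
      by (rule continuous_at_imp_continuous_on) (blast intro: DERIV_continuous der)
    show "0 < \<rho>" by fact
    fix t :: complex assume "norm (0 - t) = \<rho>"
    then have "t \<in> cball 0 \<rho>" by simp
    note B[OF small[OF this]]
    moreover have "norm (f t) \<le> norm (F (u + t *s w) - H (v + t *s w))"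
      unfolding f_def vector_minus_component[symmetric] by (rule Finite_Cartesian_Product.norm_nth_le)
    ultimately show "norm (f t) \<le> B" by linarith
  qed
  moreover have "deriv f 0 = differential F u w $ i - differential H v w $ i"
    using der[of 0] r by (simp add: DERIV_imp_deriv)
  ultimately show ?thesis by simp
qed

text \<open>The definition of holomorphy asks for a complex-linear differential at each point but not for its
  continuity; Cauchy's inequality transfers uniform continuity from \<open>F\<close> to its differential.\<close>

lemma continuous_on_differential:
  fixes F :: "complex^'m \<Rightarrow> complex^'n"
  assumes F: "holomorphic_vec_on F S" and S: "open S"
  shows "continuous_on S (\<lambda>u. differential F u w $ i)"
  unfolding continuous_on_iff
proof (intro ballI allI impI)
  fix u e assume u: "u \<in> S" and e: "0 < (e::real)"
  obtain r0 where r0: "r0 > 0" "cball u r0 \<subseteq> S" using S u open_contains_cball by blast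
  define r where "r = r0 / 2"
  have r: "r > 0" using r0 by (simp add: r_def)
  define \<rho> where "\<rho> = r / (norm w + 1)"
  have w1: "norm w + 1 > 0" using norm_ge_zero[of w] by linarith
  have \<rho>: "\<rho> > 0" using r w1 by (simp add: \<rho>_def)
  have \<rho>w: "\<rho> * norm w < r"
    using r w1 by (simp add: \<rho>_def field_simps)
  have "uniformly_continuous_on (cball u r0) F"
    by (meson F compact_cball compact_uniformly_continuous continuous_on_subset
        holomorphic_vec_on_continuous r0(2))
  then obtain d where d: "d > 0"
    "\<And>x y. x \<in> cball u r0 \<Longrightarrow> y \<in> cball u r0 \<Longrightarrow> dist y x < d \<Longrightarrow> dist (F y) (F x) < e * \<rho> / 2"
    unfolding uniformly_continuous_on_def
    by (metis e \<rho> half_gt_zero mult_pos_pos)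
  show "\<exists>d>0. \<forall>v\<in>S. dist v u < d \<longrightarrow> dist (differential F v w $ i) (differential F u w $ i) < e"
  proof (intro exI[of _ "min d r"] conjI ballI impI)
    show "0 < min d r" using d r by simp
    fix v assume v: "v \<in> S" "dist v u < min d r"
    have sub: "ball v r \<subseteq> cball u r0" "ball u r \<subseteq> cball u r0"
    proof -
      show "ball v r \<subseteq> cball u r0"
      proof
        fix x assume "x \<in> ball v r"
        then show "x \<in> cball u r0"
          using v dist_triangle[of u x v] by (auto simp: r_def dist_commute)
      qed
      show "ball u r \<subseteq> cball u r0" using r by (auto simp: r_def)
    qed
    have "cmod (differential F v w $ i - differential F u w $ i) \<le> (e * \<rho> / 2) / \<rho>"
    proof (rule differential_difference_bound[OF _ _ r \<rho> \<rho>w])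
      show "holomorphic_vec_on F (ball v r)" "holomorphic_vec_on F (ball u r)"
        using F sub r0 by (meson holomorphic_vec_on_subset subset_trans)+
      fix h :: "complex^'m" assume h: "norm h < r"
      have "v + h \<in> ball v r" "u + h \<in> ball u r" using h by (auto simp: dist_norm)
      then have "dist (F (v + h)) (F (u + h)) < e * \<rho> / 2"
        using v by (intro d(2) subsetD[OF sub(1)] subsetD[OF sub(2)]) (simp_all add: dist_norm)
      then show "norm (F (v + h) - F (u + h)) \<le> e * \<rho> / 2" by (simp add: dist_norm)
    qed
    then show "dist (differential F v w $ i) (differential F u w $ i) < e"
      using \<rho> e by (simp add: dist_norm)
  qed
qed

section \<open>Jacobians in homogeneous coordinates\<close>

definition det2 :: "(complex^2 \<Rightarrow> complex^2) \<Rightarrow> complex" where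
  "det2 A = A (axis 1 1) $ 1 * A (axis 2 1) $ 2 - A (axis 1 1) $ 2 * A (axis 2 1) $ 1"

lemma det2_eq_0_iff:
  assumes A: "complex_linear A"
  shows "det2 A = 0 \<longleftrightarrow> (\<exists>w. w \<noteq> 0 \<and> A w = 0)"
proof
  define a b where "a = A (axis 1 1)" and "b = A (axis 2 1)"
  have Aw: "A w = (w $ 1) *s a + (w $ 2) *s b" for w
    unfolding a_def b_def by (rule complex_linear_on_axes[OF A])
  have d: "det2 A = a $ 1 * b $ 2 - a $ 2 * b $ 1" by (simp add: det2_def a_def b_def)
  {
    assume "det2 A = 0"
    then have d0: "a $ 1 * b $ 2 = a $ 2 * b $ 1" using d by simp
    consider "a $ 1 \<noteq> 0 \<or> b $ 1 \<noteq> 0" | "a $ 2 \<noteq> 0 \<or> b $ 2 \<noteq> 0"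
      | "a $ 1 = 0" "b $ 1 = 0" "a $ 2 = 0" "b $ 2 = 0" by blast
    then show "\<exists>w. w \<noteq> 0 \<and> A w = 0"
    proof cases
      case 1
      then show ?thesis using d0
        by (intro exI[of _ "vector [b $ 1, - (a $ 1)]"])
           (auto simp: Aw vec_eq_iff forall_2 algebra_simps)
    next
      case 2
      then show ?thesis using d0
        by (intro exI[of _ "vector [b $ 2, - (a $ 2)]"])
           (auto simp: Aw vec_eq_iff forall_2 algebra_simps)
    next
      case 3
      then show ?thesis
        by (intro exI[of _ "vector [1, 1]"]) (auto simp: Aw vec_eq_iff forall_2)
    qed
  next
    assume "\<exists>w. w \<noteq> 0 \<and> A w = 0"
    then obtain w where w: "w \<noteq> 0" "A w = 0" by blast
    then have e: "w $ 1 * a $ 1 + w $ 2 * b $ 1 = 0" "w $ 1 * a $ 2 + w $ 2 * b $ 2 = 0"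
      using Aw[of w] by (auto simp: vec_eq_iff forall_2)
    have "w $ 1 * det2 A = 0" "w $ 2 * det2 A = 0"
      unfolding d using e by algebra+
    with w(1) show "det2 A = 0" by (auto simp: vec_eq_iff forall_2)
  }
qed

lemma bij_iff_det2:
  assumes A: "complex_linear A"
  shows "bij A \<longleftrightarrow> det2 A \<noteq> 0"
proof
  assume "bij A"
  then have "inj A" by (rule bij_is_inj)
  then show "det2 A \<noteq> 0"
    unfolding det2_eq_0_iff[OF A] using complex_linear_0[OF A] by (metis injD)
next
  assume "det2 A \<noteq> 0"
  then have "inj A"
    unfolding det2_eq_0_iff[OF A] linear_injective_0[OF complex_linear_imp_linear[OF A]] by blast
  then show "bij A"
    using linear_injective_imp_surjective[OF complex_linear_imp_linear[OF A]] by (simp add: bij_def)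
qed

text \<open>The determinant with rows \<open>u\<close>, \<open>v\<close>, \<open>w\<close>, expanded along the first row.\<close>

definition det3 :: "complex^(2 option) \<Rightarrow> complex^(2 option) \<Rightarrow> complex^(2 option) \<Rightarrow> complex" where
  "det3 u v w =
     u $ None * (v $ Some 1 * w $ Some 2 - v $ Some 2 * w $ Some 1)
   - u $ Some 1 * (v $ None * w $ Some 2 - v $ Some 2 * w $ None)
   + u $ Some 2 * (v $ None * w $ Some 1 - v $ Some 1 * w $ None)"

text \<open>A map to the projective plane with homogeneous lift \<open>\<Phi>\<close> has a singular derivative at \<open>u\<close> iff \<open>\<Phi> u\<close>
  and the partial derivatives of \<open>\<Phi>\<close> at \<open>u\<close> are linearly dependent.  This determinant detects it
  without a choice of target chart.\<close>

definition wronskian :: "(complex^2 \<Rightarrow> complex^(2 option)) \<Rightarrow> complex^2 \<Rightarrow> complex" where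
  "wronskian \<Phi> u = det3 (\<Phi> u) (differential \<Phi> u (axis 1 1)) (differential \<Phi> u (axis 2 1))"

lemma wronskian_eq:
  assumes "(\<Phi> has_derivative \<Phi>') (at u)"
  shows "wronskian \<Phi> u = det3 (\<Phi> u) (\<Phi>' (axis 1 1)) (\<Phi>' (axis 2 1))"
  unfolding wronskian_def frechet_derivative_at[OF assms, symmetric] ..

lemma forall_2_option: "(\<forall>i::2 option. P i) \<longleftrightarrow> P None \<and> P (Some 1) \<and> P (Some 2)"
  by (metis exhaust_2 option.exhaust)

lemma wronskian_smult:
  assumes "(\<Phi> has_derivative \<Phi>') (at u)" "(\<phi> has_derivative \<phi>') (at u)"
    and T: "open T" "u \<in> T" "\<And>v. v \<in> T \<Longrightarrow> \<Psi> v = \<phi> v *s \<Phi> v"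
  shows "wronskian \<Psi> u = \<phi> u ^ 3 * wronskian \<Phi> u"
proof -
  have "((\<lambda>v. \<phi> v *s \<Phi> v) has_derivative (\<lambda>h. \<phi> u *s \<Phi>' h + \<phi>' h *s \<Phi> u)) (at u)"
    by (rule has_derivative_vecI)
       (auto intro!: derivative_eq_intros has_derivative_vec_nth assms)
  then have "(\<Psi> has_derivative (\<lambda>h. \<phi> u *s \<Phi>' h + \<phi>' h *s \<Phi> u)) (at u)"
    by (rule has_derivative_transform_within_open[OF _ T(1,2)]) (simp add: T)
  from wronskian_eq[OF this] wronskian_eq[OF assms(1)] show ?thesis
    unfolding T(3)[OF T(2)] det3_def vector_add_component vector_smult_component by algebra
qed

lemma proportional_refl: "proportional v v \<longleftrightarrow> v \<noteq> 0"
  unfolding proportional_def by (auto intro!: exI[of _ 1])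

lemma cproj_eq_iff:
  assumes "v \<noteq> 0" "w \<noteq> 0"
  shows "cproj v = cproj w \<longleftrightarrow> (\<exists>c. c \<noteq> 0 \<and> w = c *s v)"
  using Quotient3_rel[OF Quotient3_cproj, of v w] assms proportional_refl[of v] proportional_refl[of w]
  unfolding proportional_def[of v w] by blast

lemma cproj_exhaust: obtains v where "v \<noteq> 0" "q = cproj v"
  by (induction q rule: cproj.abs_induct) (use proportional_refl in blast)

text \<open>In homogeneous coordinates \<open>g\<close> is polynomial, so lifts compose well with it, which chart expressions
  do not.\<close>

definition homogeneous_lift ::
    "(complex^2 \<Rightarrow> 2 cproj) \<Rightarrow> (complex^2) set \<Rightarrow> (complex^2 \<Rightarrow> complex^(2 option)) \<Rightarrow> bool" where
  "homogeneous_lift s S \<Phi> \<longleftrightarrow>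
     open S \<and> holomorphic_vec_on \<Phi> S \<and> (\<forall>v\<in>S. \<Phi> v \<noteq> 0 \<and> s v = cproj (\<Phi> v))"

definition degenerate :: "(complex^2 \<Rightarrow> 2 cproj) \<Rightarrow> complex^2 \<Rightarrow> bool" where
  "degenerate s u \<longleftrightarrow> (\<exists>S \<Phi>. homogeneous_lift s S \<Phi> \<and> u \<in> S \<and> wronskian \<Phi> u = 0)"

text \<open>Two lifts of the same map differ by a nonvanishing holomorphic factor, and the Wronskian is
  multiplied by the cube of that factor.  Hence degeneracy can be tested on any lift.\<close>

lemma degenerate_iff:
  assumes \<Psi>: "homogeneous_lift s T \<Psi>" "u \<in> T"
  shows "degenerate s u \<longleftrightarrow> wronskian \<Psi> u = 0"
proof
  assume "wronskian \<Psi> u = 0" then show "degenerate s u"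
    unfolding degenerate_def using assms by blast
next
  assume "degenerate s u"
  then obtain S \<Phi> where \<Phi>: "homogeneous_lift s S \<Phi>" "u \<in> S" "wronskian \<Phi> u = 0"
    unfolding degenerate_def by blast
  have o: "open S" "open T" and h: "holomorphic_vec_on \<Phi> S" "holomorphic_vec_on \<Psi> T"
    and s: "\<And>v. v \<in> S \<Longrightarrow> \<Phi> v \<noteq> 0 \<and> s v = cproj (\<Phi> v)"
    "\<And>v. v \<in> T \<Longrightarrow> \<Psi> v \<noteq> 0 \<and> s v = cproj (\<Psi> v)"
    using \<Phi> \<Psi> unfolding homogeneous_lift_def by auto
  obtain i where i: "\<Phi> u $ i \<noteq> 0" using s(1)[OF \<Phi>(2)] by (auto simp: vec_eq_iff)
  define \<phi> where "\<phi> v = \<Psi> v $ i / \<Phi> v $ i" for v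
  have "holomorphic_fun_at \<phi> u"
    unfolding \<phi>_def using holomorphic_fun_at_nth[OF h(1) \<Phi>(2)] holomorphic_fun_at_nth[OF h(2) \<Psi>(2)] i
    by (intro holomorphic_fun_at_divide) auto
  then obtain \<phi>' where \<phi>': "(\<phi> has_derivative \<phi>') (at u)" unfolding holomorphic_fun_at_def by blast
  have "continuous_on S (\<lambda>v. \<Phi> v $ i)"
    using holomorphic_vec_on_continuous[OF h(1)] by (intro continuous_intros)
  then have "open (S \<inter> (\<lambda>v. \<Phi> v $ i) -` (- {0}))"
    by (intro continuous_open_preimage o) auto
  then have oU: "open (S \<inter> (\<lambda>v. \<Phi> v $ i) -` (- {0}) \<inter> T)" using o by blast
  have "wronskian \<Psi> u = \<phi> u ^ 3 * wronskian \<Phi> u"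
  proof (rule wronskian_smult[OF holomorphic_vec_on_differential(1)[OF h(1) \<Phi>(2)] \<phi>' oU])
    show "u \<in> S \<inter> (\<lambda>v. \<Phi> v $ i) -` (- {0}) \<inter> T" using \<Phi> \<Psi> i by auto
    fix v assume v: "v \<in> S \<inter> (\<lambda>v. \<Phi> v $ i) -` (- {0}) \<inter> T"
    then obtain c where "\<Psi> v = c *s \<Phi> v"
      using s(1)[of v] s(2)[of v] cproj_eq_iff[of "\<Phi> v" "\<Psi> v"] by auto
    with v show "\<Psi> v = \<phi> v *s \<Phi> v" by (simp add: \<phi>_def)
  qed
  then show "wronskian \<Psi> u = 0" using \<Phi>(3) by simp
qed

definition g_lift :: "complex^(2 option) \<Rightarrow> complex^(2 option)" where
  "g_lift v = triple ((v $ None - 2 * v $ Some 1)\<^sup>2) ((v $ None - 2 * v $ Some 2)\<^sup>2) ((v $ None)\<^sup>2)"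

definition critical_form :: "complex^(2 option) \<Rightarrow> complex" where
  "critical_form v = v $ None * (v $ None - 2 * v $ Some 1) * (v $ None - 2 * v $ Some 2)"

definition critical_point :: "2 cproj \<Rightarrow> bool" where
  "critical_point q \<longleftrightarrow> (\<exists>v. v \<noteq> 0 \<and> q = cproj v \<and> critical_form v = 0)"

lemma critical_form_scale: "critical_form (c *s v) = c ^ 3 * critical_form v"
  by (simp add: critical_form_def algebra_simps power3_eq_cube)

lemma critical_point_cproj: "v \<noteq> 0 \<Longrightarrow> critical_point (cproj v) \<longleftrightarrow> critical_form v = 0"
  unfolding critical_point_def
  by (metis cproj_eq_iff critical_form_scale mult_eq_0_iff power_not_zero)

lemma g_lift_nonzero: "v \<noteq> 0 \<Longrightarrow> g_lift v \<noteq> 0"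
  by (auto simp: g_lift_def vec_eq_iff forall_2_option)

lemma g_cproj:
  assumes "v \<noteq> 0" shows "g (cproj v) = cproj (g_lift v)"
  using g.abs_eq[of v] assms unfolding proportional_refl Let_def g_lift_def by simp

text \<open>Write \<open>g_lift\<close> as the squaring of all coordinates after a linear map \<open>M\<close> of determinant 4.  If \<open>l\<close>
  is the diagonal matrix of the coordinates of \<open>M \<Phi>\<close>, then the lift is \<open>l M \<Phi>\<close> and its partial derivatives
  are \<open>2 l M\<close> applied to those of \<open>\<Phi>\<close>.  This gives the factor \<open>4 * 2 * 2\<close>, and \<open>det l\<close> is \<open>critical_form\<close>.\<close>

lemma wronskian_g_lift:
  assumes "(\<Phi> has_derivative \<Phi>') (at u)"
  shows "wronskian (\<lambda>v. g_lift (\<Phi> v)) u = 16 * critical_form (\<Phi> u) * wronskian \<Phi> u"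
proof -
  let ?D = "\<lambda>h. triple
      (2 * (\<Phi> u $ None - 2 * \<Phi> u $ Some 1) * (\<Phi>' h $ None - 2 * \<Phi>' h $ Some 1))
      (2 * (\<Phi> u $ None - 2 * \<Phi> u $ Some 2) * (\<Phi>' h $ None - 2 * \<Phi>' h $ Some 2))
      (2 * \<Phi> u $ None * \<Phi>' h $ None)"
  have "\<forall>i. ((\<lambda>v. g_lift (\<Phi> v) $ i) has_derivative (\<lambda>h. ?D h $ i)) (at u)"
    unfolding forall_2_option g_lift_def triple_nth
    by (auto intro!: derivative_eq_intros has_derivative_vec_nth assms simp: fun_eq_iff algebra_simps)
  then have "((\<lambda>v. g_lift (\<Phi> v)) has_derivative ?D) (at u)"
    by (intro has_derivative_vecI) blast
  from wronskian_eq[OF this] wronskian_eq[OF assms(1)] show ?thesis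
    unfolding det3_def critical_form_def g_lift_def triple_nth by algebra
qed

lemma homogeneous_lift_g:
  assumes "homogeneous_lift s S \<Phi>"
  shows "homogeneous_lift (\<lambda>v. g (s v)) S (\<lambda>v. g_lift (\<Phi> v))"
proof -
  have h: "holomorphic_vec_on \<Phi> S" using assms unfolding homogeneous_lift_def by blast
  have "\<forall>i. holomorphic_fun_at (\<lambda>v. g_lift (\<Phi> v) $ i) u" if "u \<in> S" for u
    unfolding forall_2_option g_lift_def triple_nth
    by (intro conjI holomorphic_fun_at_intros holomorphic_fun_at_nth[OF h that])
  then have "holomorphic_vec_on (\<lambda>v. g_lift (\<Phi> v)) S"
    unfolding holomorphic_vec_on_componentwise by blast
  with assms show ?thesis
    unfolding homogeneous_lift_def by (auto simp: g_cproj g_lift_nonzero)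
qed

lemma degenerate_g:
  assumes "homogeneous_lift s S \<Phi>" "u \<in> S"
  shows "degenerate (\<lambda>v. g (s v)) u \<longleftrightarrow> critical_point (s u) \<or> degenerate s u"
proof -
  have \<Phi>: "holomorphic_vec_on \<Phi> S" "\<Phi> u \<noteq> 0" "s u = cproj (\<Phi> u)"
    using assms unfolding homogeneous_lift_def by auto
  show ?thesis
    unfolding degenerate_iff[OF homogeneous_lift_g[OF assms(1)] assms(2)] degenerate_iff[OF assms]
      \<Phi>(3) critical_point_cproj[OF \<Phi>(2)]
      wronskian_g_lift[OF holomorphic_vec_on_differential(1)[OF \<Phi>(1) assms(2)]]
    by simp
qed

lemma homogeneous_lift_affine:
  assumes A: "complex_linear A" and \<Phi>: "homogeneous_lift s S \<Phi>"
  shows "homogeneous_lift (\<lambda>v. s (A v + c)) ((\<lambda>v. A v + c) -` S) (\<lambda>v. \<Phi> (A v + c))"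
proof -
  have hA: "holomorphic_vec_on (\<lambda>v. A v + c) UNIV" by (rule holomorphic_vec_on_affine[OF A])
  have "open ((\<lambda>v. A v + c) -` S)"
    using \<Phi> holomorphic_vec_on_continuous[OF hA] unfolding homogeneous_lift_def
    by (simp add: continuous_open_vimage continuous_on_eq_continuous_at)
  then show ?thesis
    using \<Phi> holomorphic_vec_on_compose[OF holomorphic_vec_on_subset[OF hA], of "(\<lambda>v. A v + c) -` S" \<Phi> S]
    unfolding homogeneous_lift_def by auto
qed

lemma degenerate_affine:
  assumes A: "complex_linear A" and \<Phi>: "homogeneous_lift s S \<Phi>" "A u + c \<in> S"
  shows "degenerate (\<lambda>v. s (A v + c)) u \<longleftrightarrow> det2 A = 0 \<or> degenerate s (A u + c)"
proof -
  define L where "L = differential \<Phi> (A u + c)"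
  have h: "holomorphic_vec_on \<Phi> S" using \<Phi> unfolding homogeneous_lift_def by blast
  have L: "(\<Phi> has_derivative L) (at (A u + c))" "complex_linear L"
    unfolding L_def using holomorphic_vec_on_differential[OF h \<Phi>(2)] by blast+
  have "((\<lambda>v. A v + c) has_derivative A) (at u)"
    by (auto intro!: derivative_eq_intros bounded_linear_imp_has_derivative
        complex_linear_imp_bounded_linear A)
  from has_derivative_compose[OF this L(1)]
  have d: "((\<lambda>v. \<Phi> (A v + c)) has_derivative (\<lambda>h. L (A h))) (at u)" .
  have "wronskian (\<lambda>v. \<Phi> (A v + c)) u = det2 A * wronskian \<Phi> (A u + c)"
    unfolding wronskian_eq[OF d] wronskian_eq[OF L(1)]
      complex_linear_on_axes[OF L(2), of "A (axis 1 1)"] complex_linear_on_axes[OF L(2), of "A (axis 2 1)"]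
    unfolding det2_def det3_def vector_add_component vector_smult_component by algebra
  then show ?thesis
    using degenerate_iff[OF homogeneous_lift_affine[OF A \<Phi>(1)], of u] degenerate_iff[OF \<Phi>] \<Phi>(2)
    by simp
qed

section \<open>Affine charts and the critical set of g\<close>

abbreviation affine_lift :: "2 option \<Rightarrow> (2 \<Rightarrow> 2 option) \<Rightarrow> complex^2 \<Rightarrow> complex^(2 option)" where
  "affine_lift i e u \<equiv> (\<chi> j. if j = i then 1 else u $ inv_into UNIV e j)"

lemma cproj_space_eq:
  "(cproj_space :: (2, 2 cproj) atlas) =
     {(UNIV, \<lambda>u. cproj (affine_lift i e u)) | i e. bij_betw e UNIV (- {i})}"
  unfolding cproj_space_def ..

lemma holomorphic_affine_lift: "holomorphic_vec_on (affine_lift i e) S"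
  unfolding holomorphic_vec_on_componentwise
proof (intro ballI allI)
  fix u j
  show "holomorphic_fun_at (\<lambda>v. affine_lift i e v $ j) u"
    by (cases "j = i") (simp_all add: holomorphic_fun_at_const holomorphic_fun_at_coordinate)
qed

lemma affine_lift_nonzero: "affine_lift i e u \<noteq> 0"
  by (auto simp: vec_eq_iff)

lemma homogeneous_lift_chart:
  assumes "holomorphic_vec_on F S" "open S" "\<And>v. v \<in> S \<Longrightarrow> s v = cproj (affine_lift i e (F v))"
  shows "homogeneous_lift s S (\<lambda>v. affine_lift i e (F v))"
  using assms holomorphic_vec_on_compose[OF assms(1) holomorphic_affine_lift[of i e UNIV]] affine_lift_nonzero
  unfolding homogeneous_lift_def by blast

lemma homogeneous_lift_affine_chart:
  "homogeneous_lift (\<lambda>v. cproj (affine_lift i e v)) UNIV (affine_lift i e)"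
  using holomorphic_affine_lift affine_lift_nonzero unfolding homogeneous_lift_def by blast

text \<open>In an affine chart the homogeneous lift is \<open>1\<close> in one place and the chart expression in the other
  two, so its Wronskian is, up to sign, the Jacobian determinant of the chart expression.\<close>

lemma wronskian_chart:
  assumes e: "bij_betw e UNIV (- {i})" and F: "(F has_derivative F') (at u)"
  shows "wronskian (\<lambda>v. affine_lift i e (F v)) u = 0 \<longleftrightarrow> det2 F' = 0"
proof -
  define k where "k = inv_into UNIV e"
  have k: "bij_betw k (- {i}) UNIV" unfolding k_def by (rule bij_betw_inv_into[OF e])
  let ?L' = "\<lambda>h. \<chi> j. if j = i then 0 else F' h $ k j"
  have "((\<lambda>v. affine_lift i e (F v)) has_derivative ?L') (at u)"
  proof (rule has_derivative_vecI)
    fix j show "((\<lambda>v. affine_lift i e (F v) $ j) has_derivative (\<lambda>h. ?L' h $ j)) (at u)"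
      using has_derivative_vec_nth[OF F] by (cases "j = i") (simp_all add: k_def)
  qed
  from wronskian_eq[OF this]
  have w: "wronskian (\<lambda>v. affine_lift i e (F v)) u =
      det3 (\<chi> j. if j = i then 1 else F u $ k j) (?L' (axis 1 1)) (?L' (axis 2 1))"
    unfolding k_def .
  have inj: "\<And>x y. x \<noteq> i \<Longrightarrow> y \<noteq> i \<Longrightarrow> k x = k y \<Longrightarrow> x = y"
    using k unfolding bij_betw_def inj_on_def by auto
  have two: "k x = 1 \<or> k x = 2" for x by (rule exhaust_2)
  consider "i = None" | "i = Some 1" | "i = Some 2" by (metis exhaust_2 option.exhaust)
  then show ?thesis
  proof cases
    case 1
    with inj[of "Some 1" "Some 2"] two[of "Some 1"] two[of "Some 2"]
    have "(k (Some 1) = 1 \<and> k (Some 2) = 2) \<or> (k (Some 1) = 2 \<and> k (Some 2) = 1)" by auto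
    then show ?thesis unfolding w using 1 by (auto simp: det3_def det2_def algebra_simps)
  next
    case 2
    with inj[of None "Some 2"] two[of None] two[of "Some 2"]
    have "(k None = 1 \<and> k (Some 2) = 2) \<or> (k None = 2 \<and> k (Some 2) = 1)" by auto
    then show ?thesis unfolding w using 2 by (auto simp: det3_def det2_def algebra_simps)
  next
    case 3
    with inj[of None "Some 1"] two[of None] two[of "Some 1"]
    have "(k None = 1 \<and> k (Some 1) = 2) \<or> (k None = 2 \<and> k (Some 1) = 1)" by auto
    then show ?thesis unfolding w using 3 by (auto simp: det3_def det2_def algebra_simps)
  qed
qed

lemma dehomogenize:
  assumes e: "bij_betw e UNIV (- {i})" and v: "v $ i \<noteq> 0"
  shows "cproj (affine_lift i e (\<chi> k. v $ e k / v $ i)) = cproj v"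
proof -
  have "e (inv_into UNIV e j) = j" if "j \<noteq> i" for j
    using bij_betw_inv_into_right[OF e] that by simp
  then have "v = (v $ i) *s affine_lift i e (\<chi> k. v $ e k / v $ i)"
    using v by (auto simp: vec_eq_iff)
  moreover have "v \<noteq> 0" using v by auto
  ultimately show ?thesis
    using v cproj_eq_iff[OF affine_lift_nonzero \<open>v \<noteq> 0\<close>] by blast
qed

lemma chart_enumeration: "\<exists>e. bij_betw e (UNIV :: 2 set) (- {i :: 2 option})"
proof -
  have "card (- {i}) = card (UNIV :: 2 set)"
    using card_Diff_singleton[of i UNIV] by (simp add: Compl_eq_Diff_UNIV)
  then show ?thesis
    using finite_same_card_bij[of "UNIV :: 2 set" "- {i}"] by simp
qed

lemma cproj_in_chart:
  obtains i e u where "bij_betw e (UNIV :: 2 set) (- {i :: 2 option})" "q = cproj (affine_lift i e u)"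
proof -
  obtain v where v: "v \<noteq> 0" "q = cproj v" by (rule cproj_exhaust)
  then obtain i where "v $ i \<noteq> 0" by (auto simp: vec_eq_iff)
  moreover obtain e where e: "bij_betw e (UNIV :: 2 set) (- {i})" using chart_enumeration by blast
  ultimately have "q = cproj (affine_lift i e (\<chi> k. v $ e k / v $ i))"
    using v(2) dehomogenize[OF e] by simp
  with e show ?thesis by (rule that)
qed

lemma points_cproj_space: "points (cproj_space :: (2, 2 cproj) atlas) = UNIV"
proof -
  have "q \<in> points cproj_space" for q :: "2 cproj"
  proof -
    obtain i e u where "bij_betw e (UNIV :: 2 set) (- {i :: 2 option})" "q = cproj (affine_lift i e u)"
      by (rule cproj_in_chart)
    then show ?thesis
      unfolding points_def cproj_space_eq by (intro UN_I[of "(UNIV, \<lambda>u. cproj (affine_lift i e u))"]) auto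
  qed
  then show ?thesis by blast
qed

lemma holomorphic_map_g: "holomorphic_map cproj_space cproj_space g"
  unfolding holomorphic_map_def
proof
  fix q :: "2 cproj"
  obtain i e u where e: "bij_betw e (UNIV :: 2 set) (- {i :: 2 option})" and u: "q = cproj (affine_lift i e u)"
    by (rule cproj_in_chart)
  define H where "H v = g_lift (affine_lift i e v)" for v
  have H: "homogeneous_lift (\<lambda>v. g (cproj (affine_lift i e v))) UNIV H"
    unfolding H_def by (intro homogeneous_lift_g homogeneous_lift_affine_chart)
  then have hH: "holomorphic_vec_on H UNIV" and H0: "\<And>v. H v \<noteq> 0"
    and gH: "\<And>v. g (cproj (affine_lift i e v)) = cproj (H v)"
    unfolding homogeneous_lift_def by auto
  obtain i' where i': "H u $ i' \<noteq> 0" using H0[of u] by (auto simp: vec_eq_iff)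
  obtain e' where e': "bij_betw e' (UNIV :: 2 set) (- {i' :: 2 option})" using chart_enumeration by blast
  define S where "S = (\<lambda>v. H v $ i') -` (- {0})"
  define F where "F v = (\<chi> k. H v $ e' k / H v $ i')" for v
  have "open S"
    unfolding S_def using holomorphic_vec_on_continuous[OF hH]
    by (intro continuous_open_vimage) (auto simp: continuous_on_eq_continuous_at intro!: continuous_intros)
  moreover have "holomorphic_vec_on F S"
    unfolding holomorphic_vec_on_componentwise F_def S_def
    using holomorphic_fun_at_nth[OF hH] by (auto intro!: holomorphic_fun_at_divide)
  moreover have "g (cproj (affine_lift i e v)) = cproj (affine_lift i' e' (F v))" if "v \<in> S" for v
    using that dehomogenize[OF e', of "H v"] unfolding F_def gH S_def by simp
  ultimately have "local_expression cproj_space cproj_space g (\<lambda>u. cproj (affine_lift i e u)) S F"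
    unfolding local_expression_def cproj_space_eq using e e' by blast
  moreover have "q \<in> (\<lambda>u. cproj (affine_lift i e u)) ` S" using u i' unfolding S_def by auto
  ultimately show "\<exists>p S F. local_expression cproj_space cproj_space g p S F \<and> q \<in> p ` S" by blast
qed

text \<open>A chart expression of \<open>g\<close> yields two lifts of \<open>g\<close> composed with the source chart: one through
  \<open>g_lift\<close>, one through the target chart.  Comparing their Wronskians identifies the critical points.\<close>

lemma critical_point_local_expression:
  assumes "local_expression cproj_space cproj_space g p S F" "u \<in> S" "(F has_derivative F') (at u)"
  shows "critical_point (p u) \<longleftrightarrow> \<not> bij F'"
proof -
  obtain i e i' e' where e: "bij_betw e (UNIV :: 2 set) (- {i})" "p = (\<lambda>u. cproj (affine_lift i e u))"
    and e': "bij_betw e' (UNIV :: 2 set) (- {i'})"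
    and S: "open S" "\<forall>u\<in>S. g (p u) = cproj (affine_lift i' e' (F u))" "holomorphic_vec_on F S"
    using assms(1) unfolding local_expression_def cproj_space_eq by auto
  have F': "complex_linear F'"
    using holomorphic_vec_on_differential(2)[OF S(3) assms(2)] frechet_derivative_at[OF assms(3)] by simp
  have p: "homogeneous_lift p UNIV (\<lambda>v. affine_lift i e v)"
    unfolding e(2) by (rule homogeneous_lift_affine_chart)
  have "\<not> degenerate p u"
  proof -
    have "det2 (\<lambda>h. h) \<noteq> 0" by (simp add: det2_def axis_def)
    then show ?thesis
      using wronskian_chart[OF e(1), of "\<lambda>v. v" "\<lambda>h. h" u] degenerate_iff[OF p] by simp
  qed
  then have "critical_point (p u) \<longleftrightarrow> degenerate (\<lambda>v. g (p v)) u"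
    using degenerate_g[OF p, of u] by simp
  also have "\<dots> \<longleftrightarrow> det2 F' = 0"
    using degenerate_iff[OF homogeneous_lift_chart[OF S(3,1)], of "\<lambda>v. g (p v)" i' e' u] S(2) assms(2)
      wronskian_chart[OF e' assms(3)] by simp
  finally show ?thesis using bij_iff_det2[OF F'] by simp
qed

lemma critical_set_g: "critical_set cproj_space g = {q. critical_point q}"
proof (intro equalityI subsetI)
  fix q :: "2 cproj" assume "q \<in> critical_set cproj_space g"
  then obtain p S F u F' where "local_expression cproj_space cproj_space g p S F" "u \<in> S" "q = p u"
      "(F has_derivative F') (at u)" "\<not> bij F'"
    unfolding critical_set_def mem_Collect_eq by blast
  then show "q \<in> {q. critical_point q}"
    using critical_point_local_expression[of p S F u F'] by simp
next
  fix q assume q: "q \<in> {q. critical_point q}"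
  have "q \<in> points cproj_space" by (simp add: points_cproj_space)
  then obtain p S F u where p: "local_expression cproj_space cproj_space g p S F" "u \<in> S" "q = p u"
    using holomorphic_map_g unfolding holomorphic_map_def by blast
  then have d: "(F has_derivative differential F u) (at u)"
    unfolding local_expression_def using holomorphic_vec_on_differential(1) by blast
  with p q have "\<not> bij (differential F u)"
    using critical_point_local_expression[OF p(1,2) d] by simp
  with p d show "q \<in> critical_set cproj_space g"
    unfolding critical_set_def mem_Collect_eq by blast
qed

section \<open>Homogeneous polynomials\<close>

lemma finite_exponents: "finite {\<alpha> :: 'n::finite \<Rightarrow> nat. (\<Sum>i\<in>UNIV. \<alpha> i) = d}"
proof (rule finite_subset)
  show "{\<alpha> :: 'n \<Rightarrow> nat. (\<Sum>i\<in>UNIV. \<alpha> i) = d} \<subseteq> PiE UNIV (\<lambda>_. {..d})"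
  proof
    fix \<alpha> :: "'n \<Rightarrow> nat" assume "\<alpha> \<in> {\<alpha>. (\<Sum>i\<in>UNIV. \<alpha> i) = d}"
    then have "\<alpha> i \<le> d" for i using member_le_sum[of i UNIV \<alpha>] by simp
    then show "\<alpha> \<in> PiE UNIV (\<lambda>_. {..d})" by (simp add: PiE_UNIV_domain)
  qed
qed (rule finite_PiE, auto)

lemma homogeneous_poly_const: "homogeneous_poly 0 (\<lambda>v :: complex^'n. a)"
proof -
  have "{\<alpha> :: 'n \<Rightarrow> nat. (\<Sum>i\<in>UNIV. \<alpha> i) = 0} = {\<lambda>_. 0}" by (auto simp: fun_eq_iff)
  then show ?thesis
    unfolding homogeneous_poly_def by (intro exI[of _ "\<lambda>_. a"]) simp
qed

lemma homogeneous_poly_diff: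
  assumes "homogeneous_poly d P" "homogeneous_poly d Q"
  shows "homogeneous_poly d (\<lambda>v. P v - Q v)"
proof -
  obtain b c where "P = (\<lambda>v. \<Sum>\<alpha> | (\<Sum>i\<in>UNIV. \<alpha> i) = d. b \<alpha> * (\<Prod>i\<in>UNIV. v $ i ^ \<alpha> i))"
    "Q = (\<lambda>v. \<Sum>\<alpha> | (\<Sum>i\<in>UNIV. \<alpha> i) = d. c \<alpha> * (\<Prod>i\<in>UNIV. v $ i ^ \<alpha> i))"
    using assms unfolding homogeneous_poly_def by blast
  then show ?thesis
    unfolding homogeneous_poly_def
    by (intro exI[of _ "\<lambda>\<alpha>. b \<alpha> - c \<alpha>"]) (simp add: sum_subtractf left_diff_distrib)
qed

text \<open>Multiplication by a coordinate raises one exponent by one; the new coefficient function is the old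
  one shifted, and zero on exponents that are not hit.\<close>

lemma homogeneous_poly_times_coordinate:
  fixes P :: "complex^'n \<Rightarrow> complex"
  assumes "homogeneous_poly d P"
  shows "homogeneous_poly (Suc d) (\<lambda>v. v $ i * P v)"
proof -
  define E where "E d = {\<alpha> :: 'n \<Rightarrow> nat. (\<Sum>i\<in>UNIV. \<alpha> i) = d}" for d
  define m where "m v \<alpha> = (\<Prod>j\<in>UNIV. v $ j ^ \<alpha> j)" for v :: "complex^'n" and \<alpha>
  obtain c where c: "P = (\<lambda>v. \<Sum>\<alpha>\<in>E d. c \<alpha> * m v \<alpha>)"
    using assms unfolding homogeneous_poly_def E_def m_def by blast
  define up where "up \<alpha> = \<alpha>(i := Suc (\<alpha> i))" for \<alpha> :: "'n \<Rightarrow> nat"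
  define dn where "dn \<beta> = \<beta>(i := \<beta> i - 1)" for \<beta> :: "'n \<Rightarrow> nat"
  have sum_up: "(\<Sum>j\<in>UNIV. up \<alpha> j) = Suc (\<Sum>j\<in>UNIV. \<alpha> j)" for \<alpha>
    by (simp add: up_def sum.remove[of UNIV i])
  have m_up: "m v (up \<alpha>) = v $ i * m v \<alpha>" for v \<alpha>
    by (simp add: m_def up_def prod.remove[of UNIV i])
  have dn_up: "dn (up \<alpha>) = \<alpha>" for \<alpha> by (simp add: dn_def up_def)
  have up_dn: "up (dn \<beta>) = \<beta>" if "\<beta> i > 0" for \<beta> using that by (auto simp: dn_def up_def)
  \<comment> \<open>the guard matters: \<open>dn\<close> truncates at 0 and is an inverse of \<open>up\<close> only for \<open>\<beta> i > 0\<close>\<close>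
  define c' where "c' \<beta> = (if \<beta> i > 0 then c (dn \<beta>) else 0)" for \<beta>
  have "v $ i * P v = (\<Sum>\<beta>\<in>E (Suc d). c' \<beta> * m v \<beta>)" for v
  proof -
    have "(\<Sum>\<beta>\<in>E (Suc d). c' \<beta> * m v \<beta>) = (\<Sum>\<beta>\<in>{\<beta>\<in>E (Suc d). \<beta> i > 0}. c' \<beta> * m v \<beta>)"
      by (rule sum.mono_neutral_right) (auto simp: E_def finite_exponents c'_def)
    also have "\<dots> = (\<Sum>\<alpha>\<in>E d. c \<alpha> * (v $ i * m v \<alpha>))"
    proof (rule sum.reindex_bij_witness[where i = up and j = dn])
      fix \<beta> assume b: "\<beta> \<in> {\<beta>\<in>E (Suc d). \<beta> i > 0}"
      then show "up (dn \<beta>) = \<beta>" using up_dn by simp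
      then show "dn \<beta> \<in> E d" using b sum_up[of "dn \<beta>"] by (simp add: E_def)
      show "c (dn \<beta>) * (v $ i * m v (dn \<beta>)) = c' \<beta> * m v \<beta>"
        using b m_up[of v "dn \<beta>"] up_dn[of \<beta>] by (simp add: c'_def)
    next
      fix \<alpha> assume a: "\<alpha> \<in> E d"
      show "dn (up \<alpha>) = \<alpha>" by (rule dn_up)
      show "up \<alpha> \<in> {\<beta>\<in>E (Suc d). \<beta> i > 0}" using a sum_up[of \<alpha>] by (simp add: E_def) (simp add: up_def)
    qed
    finally show ?thesis by (simp add: c sum_distrib_left algebra_simps)
  qed
  then show ?thesis unfolding homogeneous_poly_def E_def m_def by (intro exI[of _ c']) auto
qed

section \<open>The postcritical set of g\<close>

definition line_form :: "complex^(2 option) \<Rightarrow> complex" where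
  "line_form v = v $ None * (v $ Some 1 * (v $ Some 2 * ((v $ None - v $ Some 1) *
     ((v $ Some 1 - v $ Some 2) * (v $ Some 2 - v $ None)))))"

lemma homogeneous_poly_line_form: "homogeneous_poly 6 line_form"
proof -
  have *: "homogeneous_poly (Suc d) (\<lambda>v. (v $ i - v $ j) * P v)"
    if "homogeneous_poly d P" for d P and i j :: "2 option"
    using homogeneous_poly_diff[OF homogeneous_poly_times_coordinate[OF that, of i]
        homogeneous_poly_times_coordinate[OF that, of j]]
    by (simp add: left_diff_distrib)
  have 1: "homogeneous_poly (Suc 0) (\<lambda>v :: complex^(2 option). v $ Some 2 - v $ None)"
    using *[OF homogeneous_poly_const[of 1], of "Some 2" None] by simp
  have "homogeneous_poly (Suc (Suc (Suc (Suc (Suc (Suc 0)))))) line_form"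
    unfolding line_form_def by (intro homogeneous_poly_times_coordinate * 1)
  then show ?thesis by (simp add: numeral_eq_Suc)
qed

definition six_lines :: "2 cproj set" where
  "six_lines = {cproj v | v. v \<noteq> 0 \<and> line_form v = 0}"

lemma line_form_scale: "line_form (c *s v) = c ^ 6 * line_form v"
  unfolding line_form_def vector_smult_component by algebra

lemma cproj_in_six_lines: "v \<noteq> 0 \<Longrightarrow> cproj v \<in> six_lines \<longleftrightarrow> line_form v = 0"
  unfolding six_lines_def
  by (smt (verit) cproj_eq_iff line_form_scale mem_Collect_eq mult_eq_0_iff power_not_zero)

lemma g_critical_in_six_lines:
  assumes "critical_point q" shows "g q \<in> six_lines"
proof -
  obtain v where v: "v \<noteq> 0" "q = cproj v" "critical_form v = 0"
    using assms unfolding critical_point_def by blast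
  have "line_form (g_lift v) = 0"
    using v(3) by (auto simp: line_form_def g_lift_def critical_form_def)
  then show ?thesis using v by (simp add: g_cproj cproj_in_six_lines g_lift_nonzero)
qed

text \<open>The pullback of the product of the six linear forms under \<open>g_lift\<close> contains that product as a
  factor.  Among the other factors, \<open>x - y - z\<close> is the one whose line is not postcritical and makes
  a Lattes structure impossible.\<close>

lemma g_six_lines_in_six_lines:
  assumes "q \<in> six_lines" shows "g q \<in> six_lines"
proof -
  obtain v where v: "v \<noteq> 0" "q = cproj v" "line_form v = 0"
    using assms unfolding six_lines_def by blast
  have "line_form (g_lift v) = - 64 * (v $ None - v $ Some 1 - v $ Some 2) * v $ None *
      (v $ None - 2 * v $ Some 1)\<^sup>2 * (v $ None - 2 * v $ Some 2)\<^sup>2 * line_form v"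
    unfolding line_form_def g_lift_def triple_nth by algebra
  then have "line_form (g_lift v) = 0" using v(3) by simp
  then show ?thesis using v by (simp add: g_cproj cproj_in_six_lines g_lift_nonzero)
qed

lemma iterate_g_critical_in_six_lines:
  assumes "critical_point q" shows "(g ^^ Suc n) q \<in> six_lines"
  by (induction n) (use assms g_critical_in_six_lines g_six_lines_in_six_lines in auto)

text \<open>Solving \<open>x - 2y = a\<close>, \<open>x - 2z = b\<close>, \<open>x = c\<close>: the choice of signs of the square roots \<open>a\<close>, \<open>b\<close>, \<open>c\<close>
  selects one of the preimages of \<open>[a\<^sup>2 : b\<^sup>2 : c\<^sup>2]\<close>.\<close>

definition g_preimage :: "complex \<Rightarrow> complex \<Rightarrow> complex \<Rightarrow> complex^(2 option)" where
  "g_preimage a b c = triple c ((c - a) / 2) ((c - b) / 2)"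

lemma g_preimage_nonzero: "a \<noteq> 0 \<or> b \<noteq> 0 \<or> c \<noteq> 0 \<Longrightarrow> g_preimage a b c \<noteq> 0"
  by (auto simp: g_preimage_def)

lemma g_g_preimage:
  assumes "a \<noteq> 0 \<or> b \<noteq> 0 \<or> c \<noteq> 0"
  shows "g (cproj (g_preimage a b c)) = cproj (triple (a\<^sup>2) (b\<^sup>2) (c\<^sup>2))"
proof -
  have half: "c - 2 * ((c - a) / 2) = a" for a by (simp add: field_simps)
  show ?thesis
    using g_cproj[OF g_preimage_nonzero[OF assms]] unfolding g_lift_def g_preimage_def triple_nth half .
qed

text \<open>Going backwards: the coordinate lines are images of critical lines, and a point of \<open>y = z\<close>,
  \<open>x = y\<close>, \<open>x = z\<close> has a preimage on \<open>z = 0\<close>, \<open>y = z\<close>, \<open>x = y\<close> respectively.\<close>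

lemma six_lines_subset_postcritical:
  assumes "q \<in> six_lines"
  shows "\<exists>p n. critical_point p \<and> q = (g ^^ Suc n) p"
proof -
  obtain x y z where q: "q = cproj (triple x y z)" and nz: "x \<noteq> 0 \<or> y \<noteq> 0 \<or> z \<noteq> 0"
    and l: "line_form (triple x y z) = 0"
  proof -
    obtain v where v: "v \<noteq> 0" "q = cproj v" "line_form v = 0"
      using assms unfolding six_lines_def by blast
    show ?thesis
      by (rule that[of "v $ None" "v $ Some 1" "v $ Some 2"])
         (use v in \<open>auto simp: triple_eq vec_eq_iff forall_2_option\<close>)
  qed
  have sq: "(csqrt x)\<^sup>2 = x" "(- csqrt x)\<^sup>2 = x" for x by simp_all
  have coord: "\<exists>p. critical_point p \<and> cproj (triple x y z) = g p"
    if "x * y * z = 0" "x \<noteq> 0 \<or> y \<noteq> 0 \<or> z \<noteq> 0" for x y z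
  proof -
    have nz: "csqrt x \<noteq> 0 \<or> csqrt y \<noteq> 0 \<or> csqrt z \<noteq> 0" using that(2) by simp
    have "critical_form (g_preimage (csqrt x) (csqrt y) (csqrt z)) = 0"
      using that(1) by (auto simp: critical_form_def g_preimage_def field_simps)
    then show ?thesis
      using g_g_preimage[OF nz] g_preimage_nonzero[OF nz] unfolding sq critical_point_def by metis
  qed
  have yz: "\<exists>p. critical_point p \<and> cproj (triple x y y) = g (g p)" if "x \<noteq> 0 \<or> y \<noteq> 0" for x y
  proof -
    have nz: "csqrt x \<noteq> 0 \<or> csqrt y \<noteq> 0 \<or> csqrt y \<noteq> 0" using that by simp
    have e: "g_preimage (csqrt x) (csqrt y) (csqrt y) = triple (csqrt y) ((csqrt y - csqrt x) / 2) 0"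
      by (simp add: g_preimage_def)
    have "\<exists>p. critical_point p \<and> cproj (g_preimage (csqrt x) (csqrt y) (csqrt y)) = g p"
      unfolding e using that by (intro coord) auto
    then show ?thesis using g_g_preimage[OF nz] unfolding sq by metis
  qed
  have xy: "\<exists>p. critical_point p \<and> cproj (triple x x z) = g (g (g p))" if "x \<noteq> 0 \<or> z \<noteq> 0" for x z
  proof -
    have nz: "csqrt x \<noteq> 0 \<or> csqrt x \<noteq> 0 \<or> csqrt z \<noteq> 0" using that by simp
    have "\<exists>p. critical_point p \<and> cproj (g_preimage (csqrt x) (csqrt x) (csqrt z)) = g (g p)"
      unfolding g_preimage_def using that by (intro yz) auto
    then show ?thesis using g_g_preimage[OF nz] unfolding sq by metis
  qed
  have xz: "\<exists>p. critical_point p \<and> cproj (triple x y x) = g (g (g (g p)))" if "x \<noteq> 0 \<or> y \<noteq> 0" for x y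
  proof -
    \<comment> \<open>equal signs of the two roots would lead to \<open>y = 0\<close>; opposite signs lead to \<open>x = y\<close>\<close>
    have nz: "- csqrt x \<noteq> 0 \<or> csqrt y \<noteq> 0 \<or> csqrt x \<noteq> 0" using that by auto
    have e: "g_preimage (- csqrt x) (csqrt y) (csqrt x) = triple (csqrt x) (csqrt x) ((csqrt x - csqrt y) / 2)"
      by (simp add: g_preimage_def)
    have "\<exists>p. critical_point p \<and> cproj (g_preimage (- csqrt x) (csqrt y) (csqrt x)) = g (g (g p))"
      unfolding e using that by (intro xy) auto
    then show ?thesis using g_g_preimage[OF nz] unfolding sq by metis
  qed
  consider "x * y * z = 0" | "y = z" | "x = y" | "x = z"
    using l unfolding line_form_def by auto
  then show ?thesis
  proof cases
    case 1
    then obtain p where "critical_point p" "q = g p" using coord[of x y z] nz q by blast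
    then show ?thesis by (intro exI[of _ p] exI[of _ 0]) simp
  next
    case 2
    then obtain p where "critical_point p" "q = g (g p)" using yz[of x y] nz q by blast
    then show ?thesis by (intro exI[of _ p] exI[of _ "Suc 0"]) simp
  next
    case 3
    then obtain p where "critical_point p" "q = g (g (g p))" using xy[of x z] nz q by blast
    then show ?thesis by (intro exI[of _ p] exI[of _ "Suc (Suc 0)"]) simp
  next
    case 4
    then obtain p where "critical_point p" "q = g (g (g (g p)))" using xz[of x y] nz q by blast
    then show ?thesis by (intro exI[of _ p] exI[of _ "Suc (Suc (Suc 0))"]) simp
  qed
qed

lemma postcritical_set_g: "(\<Union>n\<in>{1..}. (g ^^ n) ` critical_set cproj_space g) = six_lines"
proof (intro equalityI subsetI)
  fix q assume "q \<in> (\<Union>n\<in>{1..}. (g ^^ n) ` critical_set cproj_space g)"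
  then obtain n p where "n \<ge> 1" "critical_point p" "q = (g ^^ n) p"
    unfolding critical_set_g by auto
  then show "q \<in> six_lines"
    using iterate_g_critical_in_six_lines[of p "n - 1"] by simp
next
  fix q assume "q \<in> six_lines"
  then obtain p n where "critical_point p" "q = (g ^^ Suc n) p"
    using six_lines_subset_postcritical by blast
  then show "q \<in> (\<Union>n\<in>{1..}. (g ^^ n) ` critical_set cproj_space g)"
    unfolding critical_set_g
    by (intro UN_I[of "Suc n"] image_eqI[of _ _ p]) auto
qed

lemma critically_finite_g: "critically_finite g"
  unfolding critically_finite_def postcritical_set_g algebraic_set_def
proof
  show "holomorphic_map cproj_space cproj_space g" by (rule holomorphic_map_g)
  show "\<exists>Ps. finite Ps \<and> (\<forall>P\<in>Ps. \<exists>d. homogeneous_poly d P) \<and>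
      six_lines = {cproj v |v. v \<noteq> 0 \<and> (\<forall>P\<in>Ps. P v = 0)}"
    by (intro exI[of _ "{line_form}"]) (use homogeneous_poly_line_form in \<open>auto simp: six_lines_def\<close>)
qed

section \<open>The repelling fixed point\<close>

text \<open>A primitive cube root of unity.\<close>

definition omega :: complex where "omega = Complex (- 1 / 2) (sqrt 3 / 2)"

lemma omega_sum: "1 + omega + omega\<^sup>2 = 0"
  by (simp add: omega_def complex_eq_iff power2_eq_square)

lemma norm_omega: "cmod omega = 1"
  by (simp add: omega_def cmod_def power_divide)

text \<open>The derivative of \<open>g_lift\<close> at \<open>(1, 1, 1)\<close> has the eigenvalues \<open>2\<close>, \<open>4\<omega>\<close>, \<open>4\<omega>\<^sup>2\<close>.  The forms \<open>eigen1\<close>,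
  \<open>eigen2\<close> are eigenvectors of the transpose for the last two.  They vanish at \<open>(1, 1, 1)\<close>, and their
  quotients by \<open>coordinate_sum\<close> are local coordinates at the fixed point.\<close>

definition eigen1 :: "complex^(2 option) \<Rightarrow> complex" where
  "eigen1 v = v $ None + omega\<^sup>2 * v $ Some 1 + omega * v $ Some 2"

definition eigen2 :: "complex^(2 option) \<Rightarrow> complex" where
  "eigen2 v = v $ None + omega * v $ Some 1 + omega\<^sup>2 * v $ Some 2"

definition coordinate_sum :: "complex^(2 option) \<Rightarrow> complex" where
  "coordinate_sum v = v $ None + v $ Some 1 + v $ Some 2"

definition offset :: "complex^(2 option) \<Rightarrow> real" where
  "offset v = max (cmod (eigen1 v)) (cmod (eigen2 v))"

text \<open>The distance to the fixed point in these coordinates is at most \<open>1/100\<close>, written without division.\<close>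

definition near_diagonal :: "complex^(2 option) \<Rightarrow> bool" where
  "near_diagonal v \<longleftrightarrow> 100 * offset v \<le> cmod (coordinate_sum v)"

lemma eigen_scale:
  "coordinate_sum (c *s v) = c * coordinate_sum v" "eigen1 (c *s v) = c * eigen1 v" "eigen2 (c *s v) = c * eigen2 v"
  by (simp_all add: coordinate_sum_def eigen1_def eigen2_def algebra_simps)

lemma offset_scale: "offset (c *s v) = cmod c * offset v"
  by (simp add: offset_def eigen_scale norm_mult max_mult_distrib_left)

lemma near_diagonal_scale: "c \<noteq> 0 \<Longrightarrow> near_diagonal (c *s v) \<longleftrightarrow> near_diagonal v"
  by (simp add: near_diagonal_def offset_scale eigen_scale norm_mult)

lemma offset_nonneg: "offset v \<ge> 0" by (simp add: offset_def le_max_iff_disj)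

lemma coordinates_from_eigen:
  "3 * v $ None = coordinate_sum v + eigen1 v + eigen2 v"
  "3 * v $ Some 1 = coordinate_sum v + omega * eigen1 v + omega\<^sup>2 * eigen2 v"
  "3 * v $ Some 2 = coordinate_sum v + omega\<^sup>2 * eigen1 v + omega * eigen2 v"
  using omega_sum unfolding coordinate_sum_def eigen1_def eigen2_def by algebra+

lemma near_diagonal_coordinate_sum:
  assumes "v \<noteq> 0" "near_diagonal v" shows "coordinate_sum v \<noteq> 0"
proof
  assume "coordinate_sum v = 0"
  moreover from this have "eigen1 v = 0" "eigen2 v = 0"
    using assms(2) unfolding near_diagonal_def offset_def by (auto simp: max_def split: if_splits)
  ultimately have "v = 0"
    using coordinates_from_eigen[of v] by (simp add: vec_eq_iff forall_2_option)
  with assms(1) show False ..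
qed

lemma offset_0_imp_diagonal:
  assumes "v \<noteq> 0" "offset v = 0" shows "cproj v = cproj (triple 1 1 1)"
proof -
  have e: "eigen1 v = 0" "eigen2 v = 0"
    using assms(2) unfolding offset_def by (auto simp: max_def split: if_splits)
  define c where "c = coordinate_sum v / 3"
  have v: "v = c *s triple 1 1 1"
    using coordinates_from_eigen[of v] e unfolding c_def
    by (simp add: vec_eq_iff forall_2_option mult.commute)
  with assms(1) have "c \<noteq> 0" by auto
  with v cproj_eq_iff[of "triple 1 1 1" v] assms(1) show ?thesis by auto
qed

text \<open>The exact form of \<open>g_lift\<close> in the eigencoordinates, split into the linear part and the remainder of
  second order in \<open>\<xi>\<close> and \<open>\<eta>\<close>.\<close>

lemma eigen_g_lift:
  fixes v defines "\<xi> \<equiv> eigen1 v" and "\<eta> \<equiv> eigen2 v" and "\<zeta> \<equiv> coordinate_sum v"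
  defines "a \<equiv> (1 - 2 * omega) * \<xi> + (1 - 2 * omega\<^sup>2) * \<eta>"
    and "b \<equiv> (1 - 2 * omega\<^sup>2) * \<xi> + (1 - 2 * omega) * \<eta>" and "c \<equiv> \<xi> + \<eta>"
  shows "9 * eigen1 (g_lift v) = 12 * omega * \<zeta> * \<xi> + (a\<^sup>2 + omega\<^sup>2 * b\<^sup>2 + omega * c\<^sup>2)"
    and "9 * eigen2 (g_lift v) = 12 * omega\<^sup>2 * \<zeta> * \<eta> + (a\<^sup>2 + omega * b\<^sup>2 + omega\<^sup>2 * c\<^sup>2)"
    and "9 * coordinate_sum (g_lift v) = 3 * \<zeta>\<^sup>2 + (- 6 * \<zeta> * c) + (a\<^sup>2 + b\<^sup>2 + c\<^sup>2)"
proof -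
  have 1: "3 * (v $ None - 2 * v $ Some 1) = a - \<zeta>" "3 * (v $ None - 2 * v $ Some 2) = b - \<zeta>"
    "3 * v $ None = c + \<zeta>"
    using coordinates_from_eigen[of v] unfolding a_def b_def c_def \<xi>_def \<eta>_def \<zeta>_def by algebra+
  have 2: "9 * (v $ None - 2 * v $ Some 1)\<^sup>2 = (a - \<zeta>)\<^sup>2" "9 * (v $ None - 2 * v $ Some 2)\<^sup>2 = (b - \<zeta>)\<^sup>2"
    "9 * (v $ None)\<^sup>2 = (c + \<zeta>)\<^sup>2"
    unfolding 1[symmetric] by (simp_all only: power_mult_distrib) simp_all
  have 3: "9 * eigen1 (g_lift v) = (a - \<zeta>)\<^sup>2 + omega\<^sup>2 * (b - \<zeta>)\<^sup>2 + omega * (c + \<zeta>)\<^sup>2"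
    "9 * eigen2 (g_lift v) = (a - \<zeta>)\<^sup>2 + omega * (b - \<zeta>)\<^sup>2 + omega\<^sup>2 * (c + \<zeta>)\<^sup>2"
    "9 * coordinate_sum (g_lift v) = (a - \<zeta>)\<^sup>2 + (b - \<zeta>)\<^sup>2 + (c + \<zeta>)\<^sup>2"
    unfolding 2[symmetric] coordinate_sum_def eigen1_def eigen2_def g_lift_def triple_nth by (simp_all add: algebra_simps)
  have w: "omega\<^sup>2 = - 1 - omega" using omega_sum by (simp add: algebra_simps add_eq_0_iff)
  have l: "- 2 * a - 2 * omega\<^sup>2 * b + 2 * omega * c = 12 * omega * \<xi>"
    "- 2 * a - 2 * omega * b + 2 * omega\<^sup>2 * c = 12 * omega\<^sup>2 * \<eta>"
    "- 2 * a - 2 * b + 2 * c = - 6 * c"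
    using w unfolding a_def b_def c_def by algebra+
  show "9 * eigen1 (g_lift v) = 12 * omega * \<zeta> * \<xi> + (a\<^sup>2 + omega\<^sup>2 * b\<^sup>2 + omega * c\<^sup>2)"
    "9 * eigen2 (g_lift v) = 12 * omega\<^sup>2 * \<zeta> * \<eta> + (a\<^sup>2 + omega * b\<^sup>2 + omega\<^sup>2 * c\<^sup>2)"
    "9 * coordinate_sum (g_lift v) = 3 * \<zeta>\<^sup>2 + (- 6 * \<zeta> * c) + (a\<^sup>2 + b\<^sup>2 + c\<^sup>2)"
    using 3 l omega_sum by algebra+
qed

text \<open>The leading terms alone give expansion by the factor 4.  All other terms are smaller by a constant
  times the quotient of \<open>offset v\<close> and the modulus of \<open>coordinate_sum v\<close>, which is at most \<open>1/100\<close>,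
  and cannot push the factor below 3.\<close>

lemma offset_g_lift:
  assumes near: "near_diagonal v"
  shows "3 * offset v * cmod (coordinate_sum (g_lift v)) \<le> offset (g_lift v) * cmod (coordinate_sum v)"
proof -
  define \<xi> \<eta> \<zeta> where "\<xi> = eigen1 v" and "\<eta> = eigen2 v" and "\<zeta> = coordinate_sum v"
  define a b c where "a = (1 - 2 * omega) * \<xi> + (1 - 2 * omega\<^sup>2) * \<eta>"
    and "b = (1 - 2 * omega\<^sup>2) * \<xi> + (1 - 2 * omega) * \<eta>" and "c = \<xi> + \<eta>"
  note eq = eigen_g_lift[of v, folded \<xi>_def \<eta>_def \<zeta>_def, folded a_def b_def c_def]
  define m z where "m = offset v" and "z = cmod \<zeta>"
  have m: "cmod \<xi> \<le> m" "cmod \<eta> \<le> m" "m = cmod \<xi> \<or> m = cmod \<eta>" "0 \<le> m"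
    unfolding m_def offset_def \<xi>_def \<eta>_def by (auto simp: max_def)
  have mz: "100 * m \<le> z" using near unfolding near_diagonal_def m_def z_def \<zeta>_def .
  have w2: "cmod (omega\<^sup>2) = 1" by (simp add: norm_power norm_omega)
  have w: "cmod (1 - 2 * omega) \<le> 3" "cmod (1 - 2 * omega\<^sup>2) \<le> 3"
    using norm_triangle_ineq4[of 1 "2 * omega"] norm_triangle_ineq4[of 1 "2 * omega\<^sup>2"] w2 norm_omega
    by (simp_all add: norm_mult)
  have 3: "cmod (x * \<xi> + y * \<eta>) \<le> 6 * m" if "cmod x \<le> 3" "cmod y \<le> 3" for x y
  proof -
    have "cmod (x * \<xi>) \<le> 3 * m" "cmod (y * \<eta>) \<le> 3 * m"
      unfolding norm_mult using that m by (intro mult_mono; simp)+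
    then show ?thesis using norm_triangle_ineq[of "x * \<xi>" "y * \<eta>"] by linarith
  qed
  have abc: "cmod a \<le> 6 * m" "cmod b \<le> 6 * m" "cmod c \<le> 2 * m"
    unfolding a_def b_def c_def using 3 w m norm_triangle_ineq[of \<xi> \<eta>] by auto
  have sq: "cmod (p * a\<^sup>2 + q * b\<^sup>2 + r * c\<^sup>2) \<le> 76 * m\<^sup>2"
    if "cmod p = 1" "cmod q = 1" "cmod r = 1" for p q r
  proof -
    have "(cmod a)\<^sup>2 \<le> (6 * m)\<^sup>2" "(cmod b)\<^sup>2 \<le> (6 * m)\<^sup>2" "(cmod c)\<^sup>2 \<le> (2 * m)\<^sup>2"
      using abc by (simp_all only: power_mono norm_ge_zero)
    then have "cmod (p * a\<^sup>2) \<le> 36 * m\<^sup>2" "cmod (q * b\<^sup>2) \<le> 36 * m\<^sup>2" "cmod (r * c\<^sup>2) \<le> 4 * m\<^sup>2"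
      using that by (simp_all add: norm_mult norm_power power_mult_distrib)
    then show ?thesis
      using norm_triangle_ineq[of "p * a\<^sup>2 + q * b\<^sup>2" "r * c\<^sup>2"] norm_triangle_ineq[of "p * a\<^sup>2" "q * b\<^sup>2"]
      by linarith
  qed
  have low: "9 * cmod e \<ge> 12 * z * cmod x - 76 * m\<^sup>2"
    if "9 * e = 12 * p * \<zeta> * x + q" "cmod p = 1" "cmod q \<le> 76 * m\<^sup>2" for e p q x
  proof -
    have "cmod (9 * e) \<ge> cmod (12 * p * \<zeta> * x) - cmod q"
      unfolding that(1) by (rule norm_diff_ineq)
    then show ?thesis using that(2,3) by (simp add: norm_mult z_def)
  qed
  have "9 * offset (g_lift v) \<ge> 12 * z * m - 76 * m\<^sup>2"
    using m(3)
  proof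
    assume "m = cmod \<xi>"
    then show ?thesis
      using low[OF eq(1) norm_omega] sq[of 1 "omega\<^sup>2" omega] w2 norm_omega
      unfolding offset_def by simp
  next
    assume "m = cmod \<eta>"
    then show ?thesis
      using low[OF eq(2) w2] sq[of 1 omega "omega\<^sup>2"] w2 norm_omega
      unfolding offset_def by simp
  qed
  moreover have mm: "76 * m\<^sup>2 \<le> z * m"
  proof -
    have "100 * m\<^sup>2 \<le> z * m" using mult_right_mono[OF mz m(4)] by (simp add: power2_eq_square)
    moreover have "m\<^sup>2 \<ge> 0" by simp
    ultimately show ?thesis by linarith
  qed
  ultimately have lo: "9 * offset (g_lift v) \<ge> 11 * (z * m)" by simp
  have zz: "z * m \<le> z\<^sup>2 / 100"
    using mult_left_mono[OF mz, of z] by (simp add: power2_eq_square z_def)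
  have "cmod (9 * coordinate_sum (g_lift v)) \<le> 3 * z\<^sup>2 + 6 * z * cmod c + 76 * m\<^sup>2"
    unfolding eq(3) using norm_triangle_ineq[of "3 * \<zeta>\<^sup>2 + - 6 * \<zeta> * c" "a\<^sup>2 + b\<^sup>2 + c\<^sup>2"]
      norm_triangle_ineq[of "3 * \<zeta>\<^sup>2" "- 6 * \<zeta> * c"] sq[of 1 1 1]
    by (simp add: norm_mult norm_power z_def)
  also have "6 * z * cmod c \<le> 12 * (z * m)"
    using mult_left_mono[OF abc(3), of "6 * z"] by (simp add: z_def)
  finally have "9 * cmod (coordinate_sum (g_lift v)) \<le> 3 * z\<^sup>2 + 12 * (z * m) + 76 * m\<^sup>2"
    by (simp add: norm_mult)
  moreover have "z\<^sup>2 \<ge> 0" by simp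
  ultimately have hi: "9 * cmod (coordinate_sum (g_lift v)) \<le> 11 / 3 * z\<^sup>2" using mm zz by linarith
  have "9 * (3 * m * cmod (coordinate_sum (g_lift v))) \<le> 3 * m * (11 / 3 * z\<^sup>2)"
    using mult_left_mono[OF hi, of "3 * m"] m(4) by (simp add: algebra_simps)
  also have "\<dots> = 11 * (z * m) * z" by (simp add: power2_eq_square)
  also have "\<dots> \<le> 9 * offset (g_lift v) * z"
    using mult_right_mono[OF lo, of z] by (simp add: z_def)
  finally show ?thesis unfolding m_def z_def \<zeta>_def by (simp add: mult_ac)
qed

text \<open>The distance to the fixed point triples at each step, so it must be zero if it stays bounded.\<close>

lemma diagonal_repelling:
  assumes v: "v \<noteq> 0" and near: "\<And>n. near_diagonal ((g_lift ^^ n) v)"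
  shows "cproj v = cproj (triple 1 1 1)"
proof -
  define w where "w n = (g_lift ^^ n) v" for n
  define d where "d n = offset (w n) / cmod (coordinate_sum (w n))" for n
  have w0: "w n \<noteq> 0" for n unfolding w_def by (induction n) (simp_all add: v g_lift_nonzero)
  have e0: "cmod (coordinate_sum (w n)) > 0" for n
    using near_diagonal_coordinate_sum[OF w0] near unfolding w_def by simp
  have "3 ^ n * d 0 \<le> d n" for n
  proof (induction n)
    case (Suc n)
    have "3 * offset (w n) * cmod (coordinate_sum (w (Suc n))) \<le> offset (w (Suc n)) * cmod (coordinate_sum (w n))"
      using offset_g_lift[OF near[of n]] by (simp add: w_def)
    then have "3 * d n \<le> d (Suc n)"
      unfolding d_def using e0[of n] e0[of "Suc n"] by (simp add: field_simps)
    with Suc show ?case by simp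
  qed simp
  moreover have "d n \<le> 1" for n
    unfolding d_def using e0[of n] near[of n] offset_nonneg[of "w n"] unfolding near_diagonal_def w_def by simp
  ultimately have le: "3 ^ n * d 0 \<le> 1" for n by (meson order_trans)
  have "d 0 \<le> 0"
  proof (rule ccontr)
    assume "\<not> d 0 \<le> 0"
    then obtain n where "1 / d 0 < 3 ^ n" using real_arch_pow[of 3 "1 / d 0"] by auto
    with \<open>\<not> d 0 \<le> 0\<close> le[of n] show False by (simp add: field_simps)
  qed
  then have "offset v = 0"
    using e0[of 0] offset_nonneg[of v] by (simp add: d_def w_def divide_le_0_iff)
  then show ?thesis using offset_0_imp_diagonal v by blast
qed

definition close_to_fixed_point :: "2 cproj \<Rightarrow> bool" where
  "close_to_fixed_point q \<longleftrightarrow> (\<exists>v. v \<noteq> 0 \<and> q = cproj v \<and> near_diagonal v)"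

lemma close_to_fixed_point_cproj: "v \<noteq> 0 \<Longrightarrow> close_to_fixed_point (cproj v) \<longleftrightarrow> near_diagonal v"
  unfolding close_to_fixed_point_def by (metis cproj_eq_iff near_diagonal_scale)

lemma g_iterate_cproj: "v \<noteq> 0 \<Longrightarrow> (g ^^ n) (cproj v) = cproj ((g_lift ^^ n) v) \<and> (g_lift ^^ n) v \<noteq> 0"
  by (induction n) (auto simp: g_cproj g_lift_nonzero)

lemma fixed_point_repelling:
  assumes "\<And>n. close_to_fixed_point ((g ^^ n) q)"
  shows "q = cproj (triple 1 1 1)"
proof -
  obtain v where v: "v \<noteq> 0" "q = cproj v" by (rule cproj_exhaust)
  have "near_diagonal ((g_lift ^^ n) v)" for n
    using assms[of n] g_iterate_cproj[OF v(1), of n] close_to_fixed_point_cproj unfolding v(2) by metis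
  then show ?thesis using diagonal_repelling[OF v(1)] v(2) by simp
qed

lemma g_fixed_point: "g (cproj (triple 1 1 1)) = cproj (triple 1 1 1)"
  by (simp add: g_cproj g_lift_def)

section \<open>Lattices and tori\<close>

lemma lattice_zero: "is_lattice \<Lambda> \<Longrightarrow> 0 \<in> \<Lambda>"
  unfolding is_lattice_def by (auto intro!: image_eqI[of _ _ "\<lambda>_. 0"])

lemma lattice_add: assumes "is_lattice \<Lambda>" "x \<in> \<Lambda>" "y \<in> \<Lambda>" shows "x + y \<in> \<Lambda>"
proof -
  obtain B where L: "\<Lambda> = range (\<lambda>n. \<Sum>b\<in>B. real_of_int (n b) *\<^sub>R b)"
    using assms(1) unfolding is_lattice_def by blast
  obtain m n where "x = (\<Sum>b\<in>B. real_of_int (m b) *\<^sub>R b)" "y = (\<Sum>b\<in>B. real_of_int (n b) *\<^sub>R b)"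
    using assms(2,3) unfolding L by auto
  then have "x + y = (\<Sum>b\<in>B. real_of_int (m b + n b) *\<^sub>R b)"
    by (simp add: sum.distrib scaleR_left_distrib)
  then show ?thesis unfolding L by (rule range_eqI[where x = "\<lambda>b. m b + n b"])
qed

lemma lattice_uminus: assumes "is_lattice \<Lambda>" "x \<in> \<Lambda>" shows "- x \<in> \<Lambda>"
proof -
  obtain B where L: "\<Lambda> = range (\<lambda>n. \<Sum>b\<in>B. real_of_int (n b) *\<^sub>R b)"
    using assms(1) unfolding is_lattice_def by blast
  obtain m where "x = (\<Sum>b\<in>B. real_of_int (m b) *\<^sub>R b)" using assms(2) unfolding L by auto
  then have "- x = (\<Sum>b\<in>B. real_of_int (- m b) *\<^sub>R b)" by (simp add: sum_negf)
  then show ?thesis unfolding L by (rule range_eqI[where x = "\<lambda>b. - m b"])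
qed

lemma lattice_diff: "is_lattice \<Lambda> \<Longrightarrow> x \<in> \<Lambda> \<Longrightarrow> y \<in> \<Lambda> \<Longrightarrow> x - y \<in> \<Lambda>"
  unfolding diff_conv_add_uminus by (intro lattice_add lattice_uminus)

lemma countable_lattice: assumes "is_lattice \<Lambda>" shows "countable \<Lambda>"
proof -
  obtain B where B: "independent B" "\<Lambda> = range (\<lambda>n. \<Sum>b\<in>B. real_of_int (n b) *\<^sub>R b)"
    using assms unfolding is_lattice_def by blast
  have fin: "finite B" using B(1) by (rule independent_imp_finite)
  have "\<Lambda> \<subseteq> (\<lambda>n. \<Sum>b\<in>B. real_of_int (n b) *\<^sub>R b) ` (PiE B (\<lambda>_. UNIV))"
  proof
    fix x assume "x \<in> \<Lambda>"
    then obtain n where "x = (\<Sum>b\<in>B. real_of_int (n b) *\<^sub>R b)" unfolding B(2) by auto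
    then show "x \<in> (\<lambda>n. \<Sum>b\<in>B. real_of_int (n b) *\<^sub>R b) ` (PiE B (\<lambda>_. UNIV))"
      by (intro image_eqI[of _ _ "restrict n B"]) auto
  qed
  moreover have "countable (PiE B (\<lambda>_. UNIV :: int set))" by (intro countable_PiE fin) auto
  ultimately show ?thesis by (meson countable_image countable_subset)
qed

text \<open>Round the coordinates with respect to the basis down.\<close>

lemma lattice_cocompact:
  assumes "is_lattice \<Lambda>"
  obtains R where "R > 0" "\<And>z. \<exists>l\<in>\<Lambda>. norm (z - l) \<le> R"
proof -
  obtain B where B: "independent B" "span B = UNIV" "\<Lambda> = range (\<lambda>n. \<Sum>b\<in>B. real_of_int (n b) *\<^sub>R b)"
    using assms unfolding is_lattice_def by blast
  have fin: "finite B" using B(1) by (rule independent_imp_finite)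
  show ?thesis
  proof (rule that[of "(\<Sum>b\<in>B. norm b) + 1"])
    show "(\<Sum>b\<in>B. norm b) + 1 > 0" using sum_nonneg[of B norm] by (simp add: add_nonneg_pos)
    fix z
    have "z \<in> span B" using B(2) by simp
    then obtain r where z: "z = (\<Sum>b\<in>B. r b *\<^sub>R b)" unfolding span_finite[OF fin] by auto
    define l where "l = (\<Sum>b\<in>B. real_of_int \<lfloor>r b\<rfloor> *\<^sub>R b)"
    have "l \<in> \<Lambda>" unfolding l_def B(3) by (rule range_eqI[where x = "\<lambda>b. \<lfloor>r b\<rfloor>"]) simp
    moreover have "norm (z - l) \<le> (\<Sum>b\<in>B. norm b)"
    proof -
      have "z - l = (\<Sum>b\<in>B. frac (r b) *\<^sub>R b)"
        unfolding z l_def frac_def by (simp add: sum_subtractf scaleR_left_diff_distrib)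
      also have "norm \<dots> \<le> (\<Sum>b\<in>B. norm b)"
      proof (rule sum_norm_le)
        fix b show "norm (frac (r b) *\<^sub>R b) \<le> norm b"
          using frac_lt_1[of "r b"] frac_ge_0[of "r b"] by (simp add: mult_left_le_one_le)
      qed
      finally show ?thesis .
    qed
    ultimately show "\<exists>l\<in>\<Lambda>. norm (z - l) \<le> (\<Sum>b\<in>B. norm b) + 1" by force
  qed
qed

text \<open>The coordinate functionals of the basis are bounded, and they take integer values on the lattice; so
  they vanish on lattice vectors that are short enough.\<close>

lemma lattice_discrete:
  assumes "is_lattice \<Lambda>"
  obtains \<epsilon> where "\<epsilon> > 0" "\<And>l. l \<in> \<Lambda> \<Longrightarrow> norm l < \<epsilon> \<Longrightarrow> l = 0"
proof -
  obtain B where B: "independent B" "\<Lambda> = range (\<lambda>n. \<Sum>b\<in>B. real_of_int (n b) *\<^sub>R b)"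
    using assms unfolding is_lattice_def by blast
  have fin: "finite B" using B(1) by (rule independent_imp_finite)
  have "\<exists>f K. linear f \<and> (\<forall>x\<in>B. f x = (if x = b then 1 else (0::real))) \<and> K > 0 \<and> (\<forall>z. \<bar>f z\<bar> \<le> norm z * K)" for b
  proof -
    obtain f where f: "linear f" "\<forall>x\<in>B. f x = (if x = b then 1 else (0::real))"
      using linear_independent_extend[OF B(1), of "\<lambda>x. if x = b then 1 else (0::real)"] by blast
    then have "bounded_linear f" by (simp add: linear_conv_bounded_linear)
    then obtain K where "K > 0" "\<And>z. norm (f z) \<le> norm z * K" using bounded_linear.pos_bounded by blast
    with f show ?thesis unfolding real_norm_def by blast
  qed
  then obtain f K where f: "\<And>b. linear (f b)" "\<And>b x. x \<in> B \<Longrightarrow> f b x = (if x = b then 1 else (0::real))"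
    and K: "\<And>b. K b > 0" "\<And>b z. \<bar>f b z\<bar> \<le> norm z * K b" by metis
  define M where "M = (\<Sum>b\<in>B. K b) + 1"
  have M: "M > 0" unfolding M_def using sum_nonneg[of B K] K(1) by (simp add: add_nonneg_pos less_imp_le)
  have KM: "K b \<le> M" if "b \<in> B" for b
    unfolding M_def using member_le_sum[OF that, of K] K(1) fin by (simp add: less_imp_le add_increasing2)
  show ?thesis
  proof (rule that[of "1 / M"])
    show "1 / M > 0" using M by simp
    fix l assume l: "l \<in> \<Lambda>" "norm l < 1 / M"
    then obtain n where n: "l = (\<Sum>b\<in>B. real_of_int (n b) *\<^sub>R b)" unfolding B(2) by auto
    have "n b = 0" if b: "b \<in> B" for b
    proof -
      have "f b l = (\<Sum>x\<in>B. real_of_int (n x) * f b x)"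
        unfolding n by (simp add: linear_sum[OF f(1)] linear_scale[OF f(1)])
      also have "\<dots> = (\<Sum>x\<in>B. if x = b then real_of_int (n x) else 0)"
        by (rule sum.cong) (auto simp: f(2))
      also have "\<dots> = real_of_int (n b)" using b fin by simp
      finally have "\<bar>real_of_int (n b)\<bar> \<le> norm l * K b" using K(2)[of b l] by simp
      also have "\<dots> \<le> norm l * M" using KM[OF b] by (rule mult_left_mono) simp
      also have "\<dots> < 1" using l(2) M by (simp add: field_simps)
      finally show "n b = 0" by linarith
    qed
    then show "l = 0" unfolding n by simp
  qed
qed

lemma coset_eq_iff:
  assumes "is_lattice \<Lambda>" shows "coset \<Lambda> u = coset \<Lambda> v \<longleftrightarrow> v - u \<in> \<Lambda>"
proof
  assume "coset \<Lambda> u = coset \<Lambda> v"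
  moreover have "v \<in> coset \<Lambda> v" unfolding coset_def using lattice_zero[OF assms] by force
  ultimately have "v \<in> coset \<Lambda> u" by simp
  then show "v - u \<in> \<Lambda>" unfolding coset_def by auto
next
  assume d: "v - u \<in> \<Lambda>"
  have "u + l \<in> (+) v ` \<Lambda>" if "l \<in> \<Lambda>" for l
    using lattice_diff[OF assms that d] by (intro image_eqI[of _ _ "l - (v - u)"]) auto
  moreover have "v + l \<in> (+) u ` \<Lambda>" if "l \<in> \<Lambda>" for l
    using lattice_add[OF assms that d] by (intro image_eqI[of _ _ "l + (v - u)"]) auto
  ultimately show "coset \<Lambda> u = coset \<Lambda> v" unfolding coset_def by blast
qed

lemma coset_mem: "is_lattice \<Lambda> \<Longrightarrow> u \<in> coset \<Lambda> u"
  unfolding coset_def using lattice_zero by force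

lemma points_complex_torus:
  assumes "is_lattice \<Lambda>" shows "points (complex_torus \<Lambda>) = range (coset \<Lambda>)"
proof
  show "points (complex_torus \<Lambda>) \<subseteq> range (coset \<Lambda>)" unfolding points_def complex_torus_def by auto
  obtain e where e: "e > 0" "\<And>l. l \<in> \<Lambda> \<Longrightarrow> norm l < e \<Longrightarrow> l = 0" using lattice_discrete[OF assms] by blast
  show "range (coset \<Lambda>) \<subseteq> points (complex_torus \<Lambda>)"
  proof clarify
    fix u
    have "inj_on (coset \<Lambda>) (ball u (e / 2))"
    proof (rule inj_onI)
      fix x y assume xy: "x \<in> ball u (e / 2)" "y \<in> ball u (e / 2)" "coset \<Lambda> x = coset \<Lambda> y"
      have "norm (y - x) < e"
        using xy dist_triangle_half_l[of y u e x] by (simp add: dist_commute dist_norm[symmetric])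
      then show "x = y" using e(2)[of "y - x"] xy(3) coset_eq_iff[OF assms] by simp
    qed
    then have "(ball u (e / 2), coset \<Lambda>) \<in> complex_torus \<Lambda>" unfolding complex_torus_def by auto
    moreover have "coset \<Lambda> u \<in> coset \<Lambda> ` ball u (e / 2)" using e by auto
    ultimately show "coset \<Lambda> u \<in> points (complex_torus \<Lambda>)" 
      unfolding points_def by (intro UN_I[of "(ball u (e / 2), coset \<Lambda>)"]) auto
  qed
qed

lemma holomorphic_vec_on_translate:
  assumes "holomorphic_vec_on F S" shows "holomorphic_vec_on (\<lambda>v. F (v + c)) ((\<lambda>v. v + c) -` S)"
  using holomorphic_vec_on_compose[OF holomorphic_vec_on_affine[OF vec.linear_id] assms, of c] by auto

lemma open_translate: "open S \<Longrightarrow> open ((\<lambda>v. v + c) -` S)" for S :: "'a::real_normed_vector set"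
  by (intro continuous_open_vimage) (auto intro: continuous_intros)

text \<open>A local expression around some representative of the point is moved to the representative \<open>u\<close> by a
  lattice translation.\<close>

lemma torus_local_expression:
  assumes L: "is_lattice \<Lambda>" and f: "holomorphic_map (complex_torus \<Lambda>) N f"
  obtains V q S F where "(V, q) \<in> N" "open S" "u \<in> S" "F ` S \<subseteq> V" "holomorphic_vec_on F S"
    "\<And>v. v \<in> S \<Longrightarrow> f (coset \<Lambda> v) = q (F v)"
proof -
  have "coset \<Lambda> u \<in> points (complex_torus \<Lambda>)" using points_complex_torus[OF L] by blast
  from bspec[OF f[unfolded holomorphic_map_def] this]
  obtain p S F where pSF: "local_expression (complex_torus \<Lambda>) N f p S F" "coset \<Lambda> u \<in> p ` S"
    by (elim exE conjE)
  from pSF(1) obtain W V q where 1: "(W, p) \<in> complex_torus \<Lambda>" "(V, q) \<in> N" "open S" "F ` S \<subseteq> V"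
    "\<forall>u\<in>S. f (p u) = q (F u)" "holomorphic_vec_on F S" unfolding local_expression_def by (elim exE conjE)
  have p: "p = coset \<Lambda>" using 1(1) unfolding complex_torus_def by auto
  obtain u' where u': "u' \<in> S" "coset \<Lambda> u = coset \<Lambda> u'" using pSF(2) p by auto
  define c where "c = u' - u"
  have c: "c \<in> \<Lambda>" using u'(2) coset_eq_iff[OF L] by (simp add: c_def)
  show ?thesis
  proof (rule that[OF 1(2) open_translate[OF 1(3)]])
    show "u \<in> (\<lambda>v. v + c) -` S" using u' by (simp add: c_def)
    show "(\<lambda>v. F (v + c)) ` ((\<lambda>v. v + c) -` S) \<subseteq> V" using 1(4) by auto
    show "holomorphic_vec_on (\<lambda>v. F (v + c)) ((\<lambda>v. v + c) -` S)"
      by (rule holomorphic_vec_on_translate[OF 1(6)])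
    fix v assume "v \<in> (\<lambda>v. v + c) -` S"
    moreover have "coset \<Lambda> v = coset \<Lambda> (v + c)" using c coset_eq_iff[OF L] by simp
    ultimately show "f (coset \<Lambda> v) = q (F (v + c))" using 1(5) p by simp
  qed
qed

text \<open>A continuous map with values in a discrete set is locally constant, so \<open>F\<close> and \<open>H\<close> differ by a
  constant near \<open>u\<close>.\<close>

lemma lattice_valued_differential:
  fixes F H :: "complex^'k \<Rightarrow> complex^'k"
  assumes L: "is_lattice \<Lambda>" and S: "open S" "u \<in> S"
    and F: "holomorphic_vec_on F S" "holomorphic_vec_on H S"
    and d: "\<And>v. v \<in> S \<Longrightarrow> F v - H v \<in> \<Lambda>"
  shows "differential F u = differential H u"
proof -
  obtain e where e: "e > 0" "\<And>l. l \<in> \<Lambda> \<Longrightarrow> norm l < e \<Longrightarrow> l = 0" using lattice_discrete[OF L] by blast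
  define k where "k v = (F v - H v) - (F u - H u)" for v
  have "continuous_on S k" unfolding k_def
    using F by (intro continuous_intros holomorphic_vec_on_continuous)
  then have o: "open (S \<inter> k -` ball 0 e)" by (intro continuous_open_preimage S) auto
  have "((\<lambda>v. H v + (F u - H u)) has_derivative differential H u) (at u)"
    using holomorphic_vec_on_differential(1)[OF F(2) S(2)] by (auto intro!: derivative_eq_intros)
  then have "(F has_derivative differential H u) (at u)"
  proof (rule has_derivative_transform_within_open[OF _ o])
    show "u \<in> S \<inter> k -` ball 0 e" using S e by (simp add: k_def)
    fix v assume v: "v \<in> S \<inter> k -` ball 0 e"
    then have "k v \<in> \<Lambda>" unfolding k_def using d S by (auto intro: lattice_diff[OF L])
    with v e(2) have "k v = 0" by auto
    then show "H v + (F u - H u) = F v" unfolding k_def by (simp add: algebra_simps)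
  qed
  then show ?thesis using frechet_derivative_at by metis
qed

text \<open>The differentials of the local lifts of \<open>T\<close> fit together to a continuous function \<open>DT\<close> that is
  \<open>\<Lambda>\<close>-periodic, hence bounded.  Along every complex line through the origin it is entire in the
  direction of the line, so Liouville's theorem makes it constant there; then \<open>T\<close> is affine along each such line.  Working
  along lines avoids holomorphy of \<open>DT\<close> in several variables and the lifting theory of coverings.\<close>

lemma torus_map_affine:
  fixes T :: "(complex^'k::finite) set \<Rightarrow> (complex^'k) set"
  assumes L: "is_lattice \<Lambda>" and T: "holomorphic_map (complex_torus \<Lambda>) (complex_torus \<Lambda>) T"
  obtains A c where "complex_linear A" "\<And>u. T (coset \<Lambda> u) = coset \<Lambda> (A u + c)"
proof -
  have "\<exists>S F. open S \<and> u \<in> S \<and> holomorphic_vec_on F S \<and> (\<forall>v\<in>S. T (coset \<Lambda> v) = coset \<Lambda> (F v))" for u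
  proof (rule torus_local_expression[OF L T, of u])
    fix V q S F
    assume h: "(V, q) \<in> complex_torus \<Lambda>" "open S" "u \<in> S" "holomorphic_vec_on F S"
      "\<And>v. v \<in> S \<Longrightarrow> T (coset \<Lambda> v) = q (F v)"
    have "q = coset \<Lambda>" using h(1) unfolding complex_torus_def by blast
    with h show ?thesis by blast
  qed
  then obtain S F where S: "\<And>u. open (S u)" "\<And>u. u \<in> S u" and F: "\<And>u. holomorphic_vec_on (F u) (S u)"
    and TF: "\<And>u v. v \<in> S u \<Longrightarrow> T (coset \<Lambda> v) = coset \<Lambda> (F u v)" by metis
  define DT where "DT u = differential (F u) u" for u
  \<comment> \<open>two lifts differ by a lattice vector, also after a translation of the argument by a lattice vector\<close>
  have overlap: "differential (F u) v = differential (F u') (v + l)"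
    if "v \<in> S u" "v + l \<in> S u'" "l \<in> \<Lambda>" for u u' v l
  proof -
    let ?H = "\<lambda>x. F u' (x + l)" and ?U = "S u \<inter> (\<lambda>x. x + l) -` S u'"
    have H: "holomorphic_vec_on ?H ((\<lambda>x. x + l) -` S u')" by (rule holomorphic_vec_on_translate[OF F])
    have "differential (F u) v = differential ?H v"
    proof (rule lattice_valued_differential[OF L])
      show "open ?U" using S open_translate by blast
      show "v \<in> ?U" using that by simp
      show "holomorphic_vec_on (F u) ?U" "holomorphic_vec_on ?H ?U"
        using F H holomorphic_vec_on_subset by blast+
      fix x assume x: "x \<in> ?U"
      have "coset \<Lambda> x = coset \<Lambda> (x + l)" using that coset_eq_iff[OF L] by simp
      with x TF[of x u] TF[of "x + l" u'] have "coset \<Lambda> (?H x) = coset \<Lambda> (F u x)" by simp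
      then show "F u x - ?H x \<in> \<Lambda>" using coset_eq_iff[OF L] by simp
    qed
    moreover have "(?H has_derivative differential (F u') (v + l)) (at v)"
    proof -
      have "((\<lambda>x. x + l) has_derivative (\<lambda>h. h)) (at v)" by (auto intro!: derivative_eq_intros)
      from has_derivative_compose[OF this holomorphic_vec_on_differential(1)[OF F that(2)]]
      show ?thesis .
    qed
    ultimately show ?thesis using frechet_derivative_at by metis
  qed
  have DT_local: "differential (F u) v = DT v" if "v \<in> S u" for u v
    using overlap[of v u 0 v] that S lattice_zero[OF L] unfolding DT_def by simp
  have DT_periodic: "DT (u + l) = DT u" if "l \<in> \<Lambda>" for u l
    using overlap[of u u l "u + l"] that S unfolding DT_def by simp
  have cont: "continuous_on UNIV (\<lambda>u. DT u w $ i)" for w i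
  proof -
    have "isCont (\<lambda>u. DT u w $ i) u" for u
    proof -
      have "continuous_on (S u) (\<lambda>v. DT v w $ i)"
        using continuous_on_differential[OF F S(1), of u w i] DT_local
        by (simp cong: continuous_on_cong)
      then show ?thesis using S continuous_on_eq_continuous_at by blast
    qed
    then show ?thesis by (simp add: continuous_at_imp_continuous_on)
  qed
  have bounded: "bounded (range (\<lambda>u. DT u w $ i))" for w i
  proof -
    obtain R where R: "\<And>z. \<exists>l\<in>\<Lambda>. norm (z - l) \<le> R" using lattice_cocompact[OF L] by blast
    have "range (\<lambda>u. DT u w $ i) \<subseteq> (\<lambda>u. DT u w $ i) ` cball 0 R"
    proof clarify
      fix u
      obtain l where l: "l \<in> \<Lambda>" "norm (u - l) \<le> R" using R by blast
      have "DT u = DT (u - l)" using DT_periodic[OF l(1), of "u - l"] by simp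
      with l(2) show "DT u w $ i \<in> (\<lambda>u. DT u w $ i) ` cball 0 R" by auto
    qed
    moreover have "bounded ((\<lambda>u. DT u w $ i) ` cball 0 R)"
      by (intro compact_imp_bounded compact_continuous_image continuous_on_subset[OF cont]) auto
    ultimately show ?thesis by (rule bounded_subset[rotated])
  qed
  have entire: "(\<lambda>t. DT (t *s w) w $ i) holomorphic_on UNIV" for w i
    unfolding holomorphic_on_def
  proof
    fix t0 :: complex
    define u where "u = t0 *s w"
    define U where "U = (\<lambda>t. t *s w) -` S u"
    have "continuous_on UNIV (\<lambda>t. t *s w)"
      unfolding vector_scalar_mult_def by (intro continuous_intros)
    then have U: "open U" "t0 \<in> U"
      unfolding U_def using S u_def by (auto intro!: continuous_open_vimage simp: continuous_on_eq_continuous_at)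
    let ?f = "\<lambda>t. F u (t *s w) $ i"
    have der: "(?f has_field_derivative DT (t *s w) w $ i) (at t)" if "t \<in> U" for t
      using has_field_derivative_along_line[OF F[of u], of 0 t w i] that DT_local[of "t *s w" u]
      unfolding U_def by simp
    then have "?f holomorphic_on U"
      unfolding holomorphic_on_def field_differentiable_def
      using has_field_derivative_at_within by blast
    then have "deriv ?f holomorphic_on U" by (rule holomorphic_deriv[OF _ U(1)])
    then have "(\<lambda>t. DT (t *s w) w $ i) holomorphic_on U"
      by (rule holomorphic_transform) (use der DERIV_imp_deriv in blast)
    then have "(\<lambda>t. DT (t *s w) w $ i) field_differentiable at t0"
      using U holomorphic_on_imp_differentiable_at by blast
    then show "(\<lambda>t. DT (t *s w) w $ i) field_differentiable at t0 within UNIV" by simp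
  qed
  define A where "A = DT 0"
  have const: "DT (t *s w) w = A w" for t w
  proof -
    have "DT (t *s w) w $ i = A w $ i" for i
    proof -
      have "bounded (range (\<lambda>t. DT (t *s w) w $ i))"
        by (rule bounded_subset[OF bounded[of w i]]) auto
      from Liouville_theorem[OF entire[of w i] this]
      obtain y where y: "\<And>t. DT (t *s w) w $ i = y" unfolding constant_on_def by blast
      show ?thesis using y[of t] y[of 0] by (simp add: A_def)
    qed
    then show ?thesis by (simp add: vec_eq_iff)
  qed
  have A: "complex_linear A"
    unfolding A_def DT_def by (rule holomorphic_vec_on_differential(2)[OF F S(2)])
  define c where "c = F 0 0"
  have "T (coset \<Lambda> w) = coset \<Lambda> (A w + c)" for w
  proof -
    \<comment> \<open>by connectedness the affine formula spreads from 0 to the whole line\<close>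
    define P where "P t \<longleftrightarrow> T (coset \<Lambda> (t *s w)) = coset \<Lambda> (t *s A w + c)" for t
    have "P 1"
    proof (rule connected_induction_simple[of UNIV 0 1 P])
      show "connected (UNIV :: complex set)" by (rule connected_UNIV)
      show "P 0" unfolding P_def c_def using TF[OF S(2), of 0] by simp
      fix t0 :: complex
      define u where "u = t0 *s w"
      have "continuous_on UNIV (\<lambda>t. t *s w)"
        unfolding vector_scalar_mult_def by (intro continuous_intros)
      then have "open ((\<lambda>t. t *s w) -` S u)"
        using S by (auto intro!: continuous_open_vimage simp: continuous_on_eq_continuous_at)
      moreover have "t0 \<in> (\<lambda>t. t *s w) -` S u" using S u_def by simp
      ultimately obtain r where r: "r > 0" "ball t0 r \<subseteq> (\<lambda>t. t *s w) -` S u"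
        using open_contains_ball by blast
      have eq: "F u (x *s w) - x *s A w = F u (y *s w) - y *s A w"
        if xy: "x \<in> ball t0 r" "y \<in> ball t0 r" for x y
      proof -
        have der: "((\<lambda>t. F u (t *s w) $ i - t * A w $ i) has_field_derivative 0) (at t within ball t0 r)"
          if t: "t \<in> ball t0 r" for t i
        proof -
          have "((\<lambda>t. F u (t *s w) $ i) has_field_derivative DT (t *s w) w $ i) (at t)"
            using has_field_derivative_along_line[OF F[of u], of 0 t w i] r(2) DT_local[of "t *s w" u] t by auto
          then have "((\<lambda>t. F u (t *s w) $ i - t * A w $ i) has_field_derivative 0) (at t)"
            unfolding const by (auto intro!: derivative_eq_intros)
          then show "((\<lambda>t. F u (t *s w) $ i - t * A w $ i) has_field_derivative 0) (at t within ball t0 r)"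
            by (rule has_field_derivative_at_within)
        qed
        have "F u (x *s w) $ i - x * A w $ i = F u (y *s w) $ i - y * A w $ i" for i
        proof -
          define f where "f t = F u (t *s w) $ i - t * A w $ i" for t
          have "(f has_field_derivative 0) (at t within ball t0 r)" if "t \<in> ball t0 r" for t
            unfolding f_def by (rule der[OF that])
          then have "\<exists>k. \<forall>t\<in>ball t0 r. f t = k"
            by (rule has_field_derivative_zero_constant[OF convex_ball])
          with xy show ?thesis unfolding f_def by force
        qed
        then show ?thesis by (simp add: vec_eq_iff)
      qed
      have P_iff: "P x \<longleftrightarrow> c - (F u (x *s w) - x *s A w) \<in> \<Lambda>" if "x \<in> ball t0 r" for x
      proof -
        have "T (coset \<Lambda> (x *s w)) = coset \<Lambda> (F u (x *s w))" using TF[of "x *s w" u] that r(2) by auto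
        then have "P x \<longleftrightarrow> (x *s A w + c) - F u (x *s w) \<in> \<Lambda>"
          unfolding P_def using coset_eq_iff[OF L] by metis
        also have "(x *s A w + c) - F u (x *s w) = c - (F u (x *s w) - x *s A w)" by simp
        finally show ?thesis .
      qed
      have step: "P y" if "x \<in> ball t0 r" "y \<in> ball t0 r" "P x" for x y
        using P_iff[OF that(1)] P_iff[OF that(2)] eq[OF that(1,2)] that(3) by simp
      show "\<exists>N. openin (top_of_set UNIV) N \<and> t0 \<in> N \<and> (\<forall>x\<in>N. \<forall>y\<in>N. P x \<longrightarrow> P y)"
      proof (intro exI conjI ballI impI)
        show "openin (top_of_set UNIV) (ball t0 r)" "t0 \<in> ball t0 r" using r(1) by simp_all
      qed (rule step)
    qed (rule UNIV_I)+
    then show ?thesis by (simp add: P_def)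
  qed
  with A show ?thesis by (rule that)
qed

section \<open>Expanding linear maps\<close>

lemma complex_linear_funpow_add: "complex_linear (A :: complex^'n \<Rightarrow> complex^'n) \<Longrightarrow> (A ^^ n) (v + w) = (A ^^ n) v + (A ^^ n) w"
  by (induction n) (simp_all add: complex_linear_add)

lemma complex_linear_funpow_scale: "complex_linear (A :: complex^'n \<Rightarrow> complex^'n) \<Longrightarrow> (A ^^ n) (c *s v) = c *s (A ^^ n) v"
  by (induction n) (simp_all add: complex_linear_scale)

lemma complex_linear_funpow: "complex_linear (A :: complex^'n \<Rightarrow> complex^'n) \<Longrightarrow> complex_linear (A ^^ n)"
  by (intro complex_linearI) (simp_all add: complex_linear_funpow_add complex_linear_funpow_scale)

lemma Cayley_Hamilton_2:
  assumes A: "complex_linear A"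
  shows "A (A v) = (A (axis 1 1) $ 1 + A (axis 2 1) $ 2) *s A v - det2 A *s v"
proof -
  have "A (A v) $ i = (A (axis 1 1) $ 1 + A (axis 2 1) $ 2) * A v $ i - det2 A * v $ i" for i
    unfolding complex_linear_on_axes[OF A, of "A v"] unfolding complex_linear_on_axes[OF A, of v] det2_def
    by (rule disjE[OF exhaust_2[of i]]) (simp_all add: algebra_simps)
  then show ?thesis
    by (simp only: vec_eq_iff vector_minus_component vector_smult_component simp_thms)
qed

lemma eigenvalue_exists:
  assumes A: "complex_linear A"
    and r: "r * r = (A (axis 1 1) $ 1 + A (axis 2 1) $ 2) * r - det2 A"
  shows "\<exists>w. w \<noteq> 0 \<and> A w = r *s w"
proof -
  have B: "complex_linear (\<lambda>v. A v - r *s v)"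
    using A by (intro complex_linearI)
      (simp_all add: complex_linear_add complex_linear_scale vec_eq_iff algebra_simps)
  have "det2 (\<lambda>v. A v - r *s v) = 0"
    using r by (simp add: det2_def axis_def algebra_simps)
  then show ?thesis unfolding det2_eq_0_iff[OF B] by auto
qed

text \<open>For the eigenvalues \<open>r1\<close>, \<open>r2\<close> of \<open>A\<close>, by the Cayley-Hamilton theorem \<open>w n = A (v n) - r2 v n\<close> satisfies \<open>A (w n) = r1 w n\<close>, so it decays
  geometrically; \<open>v\<close> then solves a first-order recursion with contraction factor \<open>1 / r2\<close> and decaying
  inhomogeneity \<open>w\<close>.  This also covers the case of a Jordan block, where a factor \<open>n\<close> appears.\<close>

lemma expanding_backward_orbit:
  fixes A :: "complex^2 \<Rightarrow> complex^2"
  assumes A: "complex_linear A" and eig: "\<And>w r. w \<noteq> 0 \<Longrightarrow> A w = r *s w \<Longrightarrow> cmod r > 1"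
    and v: "\<And>n. A (v (Suc n)) = v n"
  shows "v \<longlonglongrightarrow> 0"
proof -
  define \<tau> \<delta> where "\<tau> = A (axis 1 1) $ 1 + A (axis 2 1) $ 2" and "\<delta> = det2 A"
  define d where "d = csqrt (\<tau>\<^sup>2 - 4 * \<delta>)"
  define r1 r2 where "r1 = (\<tau> + d) / 2" and "r2 = (\<tau> - d) / 2"
  have d2: "d\<^sup>2 = \<tau>\<^sup>2 - 4 * \<delta>" by (simp add: d_def)
  have sum: "r1 + r2 = \<tau>" and prod: "r1 * r2 = \<delta>"
    using d2 by (simp_all add: r1_def r2_def field_simps power2_eq_square)
  have "r1 * r1 = \<tau> * r1 - \<delta>" "r2 * r2 = \<tau> * r2 - \<delta>"
    unfolding sum[symmetric] prod[symmetric] by algebra+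
  then have r: "cmod r1 > 1" "cmod r2 > 1"
    using eigenvalue_exists[OF A] eig unfolding \<tau>_def \<delta>_def by blast+
  define w where "w n = A (v n) - r2 *s v n" for n
  have Aw: "A (w n) = r1 *s w n" for n
    unfolding w_def complex_linear_diff[OF A] complex_linear_scale[OF A]
      Cayley_Hamilton_2[OF A, folded \<tau>_def \<delta>_def] sum[symmetric] prod[symmetric]
    by (simp add: vec_eq_iff algebra_simps)
  have "A (w (Suc n)) = w n" for n
    unfolding w_def complex_linear_diff[OF A] complex_linear_scale[OF A] v ..
  then have w: "w n = r1 *s w (Suc n)" for n using Aw[of "Suc n"] by simp
  have vv: "v n - w (Suc n) = r2 *s v (Suc n)" for n unfolding w_def v by simp
  define m where "m = max (1 / cmod r1) (1 / cmod r2)"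
  have m: "0 < m" "m < 1" "1 / cmod r1 \<le> m" "1 / cmod r2 \<le> m"
    using r unfolding m_def less_max_iff_disj by (auto simp: divide_less_eq)
  define C where "C = norm (w 0)"
  have wn: "norm (w n) \<le> m ^ n * C" for n
  proof (induction n)
    case (Suc n)
    have "norm (w (Suc n)) = 1 / cmod r1 * norm (w n)"
      using r(1) unfolding w[of n] norm_scale by auto
    also have "\<dots> \<le> m * (m ^ n * C)" using Suc m by (intro mult_mono) auto
    finally show ?case by simp
  qed (simp add: C_def)
  have vn: "norm (v n) \<le> m ^ n * norm (v 0) + C * (real n * m ^ n)" for n
  proof (induction n)
    case (Suc n)
    have "norm (v (Suc n)) = 1 / cmod r2 * norm (v n - w (Suc n))"
      using r(2) unfolding vv[of n] norm_scale by auto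
    also have "\<dots> \<le> m * norm (v n - w (Suc n))" using m by (intro mult_right_mono) auto
    also have "\<dots> \<le> m * (norm (v n) + norm (w (Suc n)))" using m by (intro mult_left_mono norm_triangle_ineq4) auto
    also have "\<dots> \<le> m * ((m ^ n * norm (v 0) + C * (real n * m ^ n)) + norm (w (Suc n)))"
      using Suc m by (intro mult_left_mono add_right_mono) auto
    also have "\<dots> = (m ^ Suc n * norm (v 0) + C * (real n * m ^ Suc n)) + m * norm (w (Suc n))"
      by (simp add: algebra_simps)
    also have "m * norm (w (Suc n)) \<le> 1 * (m ^ Suc n * C)" using wn[of "Suc n"] m by (intro mult_mono) auto
    finally show ?case by (simp add: algebra_simps)
  qed simp
  have "(\<lambda>n. m ^ n * norm (v 0) + C * (real n * m ^ n)) \<longlonglongrightarrow> 0 * norm (v 0) + C * 0"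
    using m by (intro tendsto_intros LIMSEQ_realpow_zero powser_times_n_limit_0) auto
  then have "(\<lambda>n. norm (v n)) \<longlonglongrightarrow> 0"
    by (intro real_tendsto_sandwich[where f = "\<lambda>_. 0" and g = "\<lambda>n. norm (v n)"] always_eventually allI)
       (simp_all add: vn)
  then show ?thesis by (rule tendsto_norm_zero_cancel)
qed

text \<open>The inverse powers of \<open>A\<close> tend to zero uniformly on bounded sets, phrased without the inverse.\<close>

lemma expanding_linear_map:
  fixes A :: "complex^2 \<Rightarrow> complex^2"
  assumes A: "complex_linear A" and eig: "\<And>w r. w \<noteq> 0 \<Longrightarrow> A w = r *s w \<Longrightarrow> cmod r > 1"
    and "\<epsilon> > 0" "R > 0"
  shows "\<exists>n. \<forall>v. norm ((A ^^ n) v) \<le> R \<longrightarrow> norm v < \<epsilon>"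
proof -
  have det: "det2 A \<noteq> 0"
    unfolding det2_eq_0_iff[OF A] using eig[of _ 0] by auto
  then have bij: "bij A" using bij_iff_det2[OF A] by simp
  define B where "B = inv_into UNIV A"
  have AB: "A (B v) = v" and BA: "B (A v) = v" for v
    unfolding B_def using bij by (simp_all add: bij_is_surj surj_f_inv_f bij_is_inj)
  have B: "complex_linear B"
    by (intro complex_linearI)
       (metis AB BA A complex_linear_add, metis AB BA A complex_linear_scale)
  have lim: "(\<lambda>n. (B ^^ n) v) \<longlonglongrightarrow> 0" for v
    by (rule expanding_backward_orbit[OF A eig]) (simp_all add: AB)
  have "(\<lambda>n. R * (norm ((B ^^ n) (axis 1 1)) + norm ((B ^^ n) (axis 2 1)))) \<longlonglongrightarrow> R * (norm (0 :: complex^2) + norm (0 :: complex^2))"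
    by (intro tendsto_intros lim)
  then have "eventually (\<lambda>n. R * (norm ((B ^^ n) (axis 1 1)) + norm ((B ^^ n) (axis 2 1))) < \<epsilon>) sequentially"
    by (rule order_tendstoD) (use \<open>\<epsilon> > 0\<close> in simp)
  then obtain n where n: "R * (norm ((B ^^ n) (axis 1 1)) + norm ((B ^^ n) (axis 2 1))) < \<epsilon>"
    unfolding eventually_sequentially by blast
  show ?thesis
  proof (intro exI allI impI)
    fix v assume v: "norm ((A ^^ n) v) \<le> R"
    have BAn: "(B ^^ n) ((A ^^ n) v) = v" for n
    proof (induction n)
      case (Suc n)
      have "(B ^^ Suc n) ((A ^^ Suc n) v) = (B ^^ n) (B (A ((A ^^ n) v)))"
        by (simp add: funpow_swap1)
      with Suc show ?case by (simp only: BA)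
    qed simp
    define u where "u = (A ^^ n) v"
    have "v = (u $ 1) *s (B ^^ n) (axis 1 1) + (u $ 2) *s (B ^^ n) (axis 2 1)"
      using complex_linear_on_axes[OF complex_linear_funpow[OF B, of n], of u] BAn unfolding u_def by simp
    then have "norm v \<le> cmod (u $ 1) * norm ((B ^^ n) (axis 1 1)) + cmod (u $ 2) * norm ((B ^^ n) (axis 2 1))"
      using norm_triangle_ineq by (metis norm_scale)
    also have "\<dots> \<le> R * norm ((B ^^ n) (axis 1 1)) + R * norm ((B ^^ n) (axis 2 1))"
      using v Finite_Cartesian_Product.norm_nth_le[of u] unfolding u_def[symmetric]
      by (intro add_mono mult_right_mono) (auto intro: order_trans)
    also have "\<dots> < \<epsilon>" using n by (simp add: algebra_simps)
    finally show "norm v < \<epsilon>" .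
  qed
qed

section \<open>A complex Sard lemma\<close>

text \<open>Mutually inverse real-linear maps that transport Sard's theorem from \<open>\<real>\<^sup>4\<close> to \<open>\<complex>\<^sup>2\<close>.\<close>

definition to_real4 :: "complex^2 \<Rightarrow> real^4" where
  "to_real4 z = (\<chi> i. if i = 1 then Re (z $ 1) else if i = 2 then Im (z $ 1)
     else if i = 3 then Re (z $ 2) else Im (z $ 2))"

definition from_real4 :: "real^4 \<Rightarrow> complex^2" where
  "from_real4 r = (\<chi> i. if i = 1 then Complex (r $ 1) (r $ 2) else Complex (r $ 3) (r $ 4))"

lemma from_to_real4: "from_real4 (to_real4 z) = z"
  by (simp add: from_real4_def to_real4_def vec_eq_iff forall_2 complex_eq_iff)

lemma to_from_real4: "to_real4 (from_real4 r) = r"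
  by (simp add: from_real4_def to_real4_def vec_eq_iff forall_4)

lemma linear_to_real4: "linear to_real4"
  by (rule linearI) (simp_all add: to_real4_def vec_eq_iff)

lemma linear_from_real4: "linear from_real4"
  by (rule linearI) (simp_all add: from_real4_def vec_eq_iff complex_eq_iff)

lemma negligible_degenerate_image:
  assumes F: "\<And>v. v \<in> X \<Longrightarrow> (F has_derivative F' v) (at v)" "\<And>v. v \<in> X \<Longrightarrow> complex_linear (F' v)"
    and deg: "\<And>v. v \<in> X \<Longrightarrow> det2 (F' v) = 0"
  shows "negligible (to_real4 ` F ` X)"
proof -
  define f where "f r = to_real4 (F (from_real4 r))" for r
  define f' where "f' r h = to_real4 (F' (from_real4 r) (from_real4 h))" for r h
  have der: "(f has_derivative f' r) (at r)" if "from_real4 r \<in> X" for r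
  proof -
    have 1: "(from_real4 has_derivative from_real4) (at r)"
      using linear_from_real4 by (simp add: linear_conv_bounded_linear bounded_linear_imp_has_derivative)
    have 2: "(to_real4 has_derivative to_real4) (at (F (from_real4 r)))"
      using linear_to_real4 by (simp add: linear_conv_bounded_linear bounded_linear_imp_has_derivative)
    show ?thesis
      unfolding f_def f'_def
      by (rule has_derivative_compose[OF has_derivative_compose[OF 1 F(1)[OF that]] 2])
  qed
  have "negligible (f ` {r. from_real4 r \<in> X})"
  proof (rule baby_Sard)
    show "CARD(4) \<le> CARD(4)" ..
    fix r assume r: "r \<in> {r. from_real4 r \<in> X}"
    then show "(f has_derivative f' r) (at r within {r. from_real4 r \<in> X})"
      using der has_derivative_at_withinI by blast
    have lin: "linear (f' r)" using der r by (auto dest: has_derivative_linear)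
    obtain w where w: "w \<noteq> 0" "F' (from_real4 r) w = 0"
      using deg r det2_eq_0_iff[OF F(2)] by auto
    have "f' r (to_real4 w) = f' r 0"
      using w linear_0[OF linear_to_real4] linear_0[OF linear_from_real4] complex_linear_0[OF F(2)] r
      by (simp add: f'_def from_to_real4)
    moreover have "to_real4 w \<noteq> 0"
      using w(1) from_to_real4[of w] linear_0[OF linear_from_real4] by auto
    ultimately have "\<not> inj (f' r)" by (meson injD)
    then have "\<not> inj ((*v) (matrix (f' r)))" using matrix_vector_mul(2)[OF lin] by simp
    then have "rank (matrix (f' r)) \<noteq> CARD(4)" using full_rank_injective by blast
    then show "rank (matrix (f' r)) < CARD(4)" using rank_bound[of "matrix (f' r)"] by simp
  qed
  moreover have "to_real4 ` F ` X \<subseteq> f ` {r. from_real4 r \<in> X}"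
  proof clarify
    fix v assume "v \<in> X"
    then show "to_real4 (F v) \<in> f ` {r. from_real4 r \<in> X}"
      by (intro image_eqI[of _ _ "to_real4 v"]) (simp_all add: f_def from_to_real4)
  qed
  ultimately show ?thesis by (rule negligible_subset)
qed

section \<open>Periodic maps onto the projective plane\<close>

text \<open>What is needed of the composition of a Galois covering with the projection of the torus.\<close>

locale toral_cover =
  fixes \<Lambda> :: "(complex^2) set" and s :: "complex^2 \<Rightarrow> 2 cproj"
  assumes lattice: "is_lattice \<Lambda>"
    and periodic: "l \<in> \<Lambda> \<Longrightarrow> s (u + l) = s u"
    and has_lift: "\<exists>S \<Phi>. homogeneous_lift s S \<Phi> \<and> u \<in> S"
    and onto: "\<exists>u. s u = q"
    and countable_fibre: "countable {u. s u = q}"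
begin

text \<open>Finitely many lifts suffice, by periodicity and compactness.  If all points were degenerate, the
  affine plane \<open>x \<noteq> 0\<close> would be a finite union of negligible images.\<close>

lemma somewhere_nondegenerate: "\<exists>u. \<not> degenerate s u"
proof (rule ccontr)
  assume "\<not> (\<exists>u. \<not> degenerate s u)"
  then have deg: "degenerate s u" for u by blast
  obtain R where R: "\<And>z. \<exists>l\<in>\<Lambda>. norm (z - l) \<le> R" using lattice_cocompact[OF lattice] by blast
  have "\<forall>u. \<exists>S. \<exists>\<Phi>. homogeneous_lift s S \<Phi> \<and> u \<in> S" using has_lift by blast
  then obtain S where "\<forall>u. \<exists>\<Phi>. homogeneous_lift s (S u) \<Phi> \<and> u \<in> S u" by metis
  then obtain \<Phi> where "\<forall>u. homogeneous_lift s (S u) (\<Phi> u) \<and> u \<in> S u" by metis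
  then have lift: "\<And>u. homogeneous_lift s (S u) (\<Phi> u)" and mem: "\<And>u. u \<in> S u" by blast+
  have S: "open (S u)" and hol: "holomorphic_vec_on (\<Phi> u) (S u)"
    and s: "\<And>v. v \<in> S u \<Longrightarrow> \<Phi> u v \<noteq> 0 \<and> s v = cproj (\<Phi> u v)" for u
    using lift[of u] unfolding homogeneous_lift_def by auto
  obtain K where K: "finite K" "cball 0 R \<subseteq> (\<Union>u\<in>K. S u)"
  proof -
    have "cball 0 R \<subseteq> (\<Union>u\<in>UNIV. S u)" using mem by blast
    from compactE_image[OF compact_cball _ this] S show ?thesis using that by metis
  qed
  obtain e where e: "bij_betw e (UNIV :: 2 set) (- {None :: 2 option})" using chart_enumeration by blast
  define X where "X u = S u \<inter> (\<lambda>v. \<Phi> u v $ None) -` (- {0})" for u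
  define F where "F u v = (\<chi> k. \<Phi> u v $ e k / \<Phi> u v $ None)" for u v
  have "open (X u)" for u
    unfolding X_def using holomorphic_vec_on_continuous[OF hol, of u] S
    by (intro continuous_open_preimage) (auto intro!: continuous_intros)
  have hF: "holomorphic_vec_on (F u) (X u)" for u
    unfolding holomorphic_vec_on_componentwise F_def X_def
    using holomorphic_fun_at_nth[OF hol] by (auto intro!: holomorphic_fun_at_divide)
  have sF: "s v = cproj (affine_lift None e (F u v))" if "v \<in> X u" for u v
    using that s[of v u] dehomogenize[OF e, of "\<Phi> u v"] unfolding F_def X_def by simp
  have neg: "negligible (to_real4 ` F u ` X u)" for u
  proof (rule negligible_degenerate_image[where F' = "differential (F u)"])
    fix v assume v: "v \<in> X u"
    show d: "(F u has_derivative differential (F u) v) (at v)" "complex_linear (differential (F u) v)"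
      using holomorphic_vec_on_differential[OF hF v] by blast+
    have "homogeneous_lift s (X u) (\<lambda>v. affine_lift None e (F u v))"
      by (rule homogeneous_lift_chart[OF hF \<open>open (X u)\<close> sF])
    from degenerate_iff[OF this v] wronskian_chart[OF e d(1)] deg
    show "det2 (differential (F u) v) = 0" by simp
  qed
  have "r \<in> (\<Union>u\<in>K. to_real4 ` F u ` X u)" for r
  proof -
    define y where "y = from_real4 r"
    obtain u0 where u0: "s u0 = cproj (affine_lift None e y)" using onto by blast
    obtain l where l: "l \<in> \<Lambda>" "norm (u0 - l) \<le> R" using R by blast
    define v where "v = u0 - l"
    have sv: "s v = cproj (affine_lift None e y)"
      using u0 periodic[OF l(1), of v] by (simp add: v_def)
    have "v \<in> cball 0 R" using l(2) by (simp add: v_def)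
    then obtain u where u: "u \<in> K" "v \<in> S u" using K(2) by blast
    have "cproj (affine_lift None e y) = cproj (\<Phi> u v)" "\<Phi> u v \<noteq> 0" using s[OF u(2)] sv by simp_all
    then obtain c where c: "c \<noteq> 0" "\<Phi> u v = c *s affine_lift None e y"
      using cproj_eq_iff[OF affine_lift_nonzero] by blast
    have "F u v $ k = y $ k" for k
    proof -
      have "e k \<in> - {None}" using bij_betwE[OF e] by blast
      moreover have "inv_into UNIV e (e k) = k" using e unfolding bij_betw_def by simp
      ultimately show ?thesis unfolding F_def c(2) using c(1) by (cases "e k") simp_all
    qed
    then have "F u v = y" by (simp add: vec_eq_iff)
    moreover have "v \<in> X u" unfolding X_def using u c by simp
    moreover have "to_real4 y = r" by (simp add: y_def to_from_real4)
    ultimately show ?thesis using u(1) by blast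
  qed
  then have "UNIV = (\<Union>u\<in>K. to_real4 ` F u ` X u)" by blast
  moreover have "negligible (\<Union>u\<in>K. to_real4 ` F u ` X u)"
    using K(1) neg by (intro negligible_Union) auto
  ultimately show False by (metis non_negligible_UNIV)
qed

text \<open>The Wronskian of a local lift is continuous, because differentials are.\<close>

lemma open_nondegenerate: "open {u. \<not> degenerate s u}"
proof (subst open_subopen, intro ballI)
  fix u assume "u \<in> {u. \<not> degenerate s u}"
  obtain S \<Phi> where \<Phi>: "homogeneous_lift s S \<Phi>" "u \<in> S" using has_lift by blast
  then have S: "open S" "holomorphic_vec_on \<Phi> S" unfolding homogeneous_lift_def by blast+
  have d: "continuous_on S (\<lambda>u. differential \<Phi> u w $ i)" for w i
    by (rule continuous_on_differential[OF S(2,1)])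
  have c: "continuous_on S (\<lambda>u. \<Phi> u $ i)" for i
    by (intro continuous_intros holomorphic_vec_on_continuous[OF S(2)])
  have "continuous_on S (\<lambda>u. wronskian \<Phi> u)"
    unfolding wronskian_def det3_def
    by (intro continuous_on_add continuous_on_diff continuous_on_mult c d)
  then have "open (S \<inter> wronskian \<Phi> -` (- {0}))"
    by (intro continuous_open_preimage S(1)) auto
  moreover have "u \<in> S \<inter> wronskian \<Phi> -` (- {0})"
    using degenerate_iff[OF \<Phi>] \<Phi>(2) \<open>u \<in> {u. \<not> degenerate s u}\<close> by simp
  moreover have "S \<inter> wronskian \<Phi> -` (- {0}) \<subseteq> {u. \<not> degenerate s u}"
    using degenerate_iff[OF \<Phi>(1)] by auto
  ultimately show "\<exists>T. open T \<and> u \<in> T \<and> T \<subseteq> {u. \<not> degenerate s u}" by blast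
qed

lemma degenerate_periodic:
  assumes "l \<in> \<Lambda>" "degenerate s u" shows "degenerate s (u + l)"
proof -
  obtain S \<Phi> where "homogeneous_lift s S \<Phi>" "u + l \<in> S" using has_lift by blast
  moreover have "complex_linear (\<lambda>v :: complex^2. v)" by (rule complex_linearI) simp_all
  ultimately have "degenerate (\<lambda>v. s (v + l)) u \<longleftrightarrow> det2 (\<lambda>v. v) = 0 \<or> degenerate s (u + l)"
    using degenerate_affine[where A = "\<lambda>v. v" and c = l] by blast
  moreover have "det2 (\<lambda>v. v) \<noteq> 0" by (simp add: det2_def axis_def)
  ultimately show ?thesis using assms periodic by simp
qed

text \<open>The chain rule for both sides of \<open>s \<circ> D = g \<circ> s\<close>.\<close>

lemma degenerate_semiconjugacy:
  assumes A: "complex_linear A" and conj: "\<And>z. s (A z + c) = g (s z)"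
  shows "det2 A = 0 \<or> degenerate s (A u + c) \<longleftrightarrow> critical_point (s u) \<or> degenerate s u"
proof -
  obtain S \<Phi> where \<Phi>: "homogeneous_lift s S \<Phi>" "A u + c \<in> S" using has_lift by blast
  obtain T \<Psi> where \<Psi>: "homogeneous_lift s T \<Psi>" "u \<in> T" using has_lift by blast
  show ?thesis using degenerate_affine[OF A \<Phi>] degenerate_g[OF \<Psi>] unfolding conj by simp
qed

text \<open>If \<open>A w = r w\<close> with \<open>r\<close> in the closed unit disc, then for small \<open>t\<close> the whole forward orbit of
  \<open>s (a + t w)\<close> stays near the repelling fixed point, so \<open>s (a + t w)\<close> is that fixed point.  This holds
  for uncountably many \<open>t\<close>, but the fibres of \<open>s\<close> are countable.\<close>

lemma expanding_at_fixed_point: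
  assumes a: "s a = cproj (triple 1 1 1)" "A a + c = a"
    and A: "complex_linear A" and conj: "\<And>z. s (A z + c) = g (s z)"
    and w: "w \<noteq> 0" "A w = r *s w"
  shows "cmod r > 1"
proof (rule ccontr)
  assume "\<not> cmod r > 1"
  then have r: "cmod r \<le> 1" by simp
  have step: "s (a + A x) = g (s (a + x))" for x
  proof -
    have "A (a + x) + c = (A a + c) + A x" unfolding complex_linear_add[OF A] by (simp add: ac_simps)
    then show ?thesis using conj[of "a + x"] unfolding a(2) by simp
  qed
  have orbit: "s (a + (r ^ n * t) *s w) = (g ^^ n) (s (a + t *s w))" for n t
  proof (induction n)
    case (Suc n)
    have "A ((r ^ n * t) *s w) = (r ^ Suc n * t) *s w"
      unfolding complex_linear_scale[OF A] w(2) by (simp add: vec_eq_iff)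
    with step[of "(r ^ n * t) *s w"] Suc show ?case by simp
  qed simp
  obtain S \<Phi> where \<Phi>: "homogeneous_lift s S \<Phi>" "a \<in> S" using has_lift by blast
  then have S: "open S" "holomorphic_vec_on \<Phi> S" and s: "\<And>v. v \<in> S \<Longrightarrow> \<Phi> v \<noteq> 0 \<and> s v = cproj (\<Phi> v)"
    unfolding homogeneous_lift_def by blast+
  define k where "k v = cmod (coordinate_sum (\<Phi> v)) - 100 * offset (\<Phi> v)" for v
  have "continuous_on S k"
    unfolding k_def offset_def coordinate_sum_def eigen1_def eigen2_def
    by (intro continuous_intros holomorphic_vec_on_continuous[OF S(2)])
  then have "open (S \<inter> k -` {0<..})" by (intro continuous_open_preimage S(1)) auto
  moreover have "a \<in> S \<inter> k -` {0<..}"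
  proof -
    obtain d where d: "d \<noteq> 0" "\<Phi> a = d *s triple 1 1 1"
      using cproj_eq_iff[of "triple 1 1 1" "\<Phi> a"] s[OF \<Phi>(2)] a(1) by auto
    have "eigen1 (triple 1 1 1) = 0" "eigen2 (triple 1 1 1) = 0"
      using omega_sum by (simp_all add: eigen1_def eigen2_def algebra_simps)
    then have "k a > 0" using d(1) unfolding k_def d(2) offset_scale eigen_scale
      by (simp add: offset_def coordinate_sum_def norm_mult)
    with \<Phi>(2) show ?thesis by simp
  qed
  ultimately obtain \<rho> where \<rho>: "\<rho> > 0" "ball a \<rho> \<subseteq> S \<inter> k -` {0<..}" using open_contains_ball by blast
  have close: "close_to_fixed_point (s v)" if "v \<in> ball a \<rho>" for v
  proof -
    have "v \<in> S" "k v > 0" using that \<rho>(2) by auto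
    then show ?thesis using s[of v] close_to_fixed_point_cproj[of "\<Phi> v"]
      by (simp add: near_diagonal_def k_def)
  qed
  define B where "B = ball (0 :: complex) (\<rho> / norm w)"
  have const: "s (a + t *s w) = cproj (triple 1 1 1)" if t: "t \<in> B" for t
  proof (rule fixed_point_repelling)
    fix n
    have "cmod (r ^ n) * cmod t \<le> 1 * cmod t"
      using r by (intro mult_right_mono) (simp_all add: norm_power power_le_one)
    then have "cmod (r ^ n * t) * norm w \<le> cmod t * norm w"
      by (intro mult_right_mono) (simp_all add: norm_mult)
    also have "\<dots> < \<rho>" using t w(1) by (simp add: B_def field_simps)
    finally have "norm ((r ^ n * t) *s w) < \<rho>" by (simp add: norm_scale)
    then have "a + (r ^ n * t) *s w \<in> ball a \<rho>" by (simp add: dist_norm)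
    from close[OF this] show "close_to_fixed_point ((g ^^ n) (s (a + t *s w)))" unfolding orbit .
  qed
  have "inj_on (\<lambda>t. a + t *s w) B"
    using w(1) by (intro inj_onI) (auto simp: vec_eq_iff)
  moreover have "countable ((\<lambda>t. a + t *s w) ` B)"
    by (rule countable_subset[OF _ countable_fibre[of "cproj (triple 1 1 1)"]]) (use const in auto)
  ultimately have "countable B" by (rule countable_image_inj_on[rotated])
  then show False using uncountable_ball[of "\<rho> / norm w" "0 :: complex"] \<rho>(1) w(1) unfolding B_def by simp
qed

end

text \<open>The last assumption allows one to prescribe the image of a point among the points of a fibre.  It
  combines a lift of the torus endomorphism with an element of the Galois group.\<close>

locale toral_semiconjugacy = toral_cover +
  assumes correspondence:
    "s v = g (s u) \<Longrightarrow> \<exists>A c. complex_linear A \<and> A u + c = v \<and> (\<forall>z. s (A z + c) = g (s z))"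
begin

text \<open>The critical orbit \<open>[0 : sqrt 2 : i]\<close>, \<open>[2 : -1 : 0]\<close>, \<open>[4 : 1 : 1]\<close>, \<open>[1 : 1 : 4]\<close> ends in a point of
  \<open>x = y\<close>, which is also the image of the noncritical point \<open>[4 : 1 : 3]\<close>.  Degeneracy is carried
  forward along the orbit by \<open>D\<close> and then pulled back to \<open>[4 : 1 : 3]\<close> by another semiconjugacy.\<close>

lemma degenerate_over_413:
  assumes A: "complex_linear A" "det2 A \<noteq> 0" and conj: "\<And>z. s (A z + c) = g (s z)"
  obtains b where "s b = cproj (triple 4 1 3)" "degenerate s b"
proof -
  define D where "D z = A z + c" for z
  define p where "p = triple 0 (complex_of_real (sqrt 2)) \<i>"
  obtain b0 where b0: "s b0 = cproj p" using onto by blast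
  obtain b where b: "s b = cproj (triple 4 1 3)" using onto by blast
  have sD: "s (D z) = g (s z)" for z unfolding D_def by (rule conj)
  have degD: "degenerate s (D z) \<longleftrightarrow> critical_point (s z) \<or> degenerate s z" for z
    unfolding D_def using degenerate_semiconjugacy[OF A(1) conj, of z] A(2) by simp
  have p: "p \<noteq> 0" "critical_point (cproj p)"
    unfolding p_def critical_point_def by (auto simp: critical_form_def intro!: exI[of _ "triple 0 (complex_of_real (sqrt 2)) \<i>"])
  have deg: "degenerate s (D (D (D b0)))" using degD p(2) b0 by simp
  have img: "s (D (D (D b0))) = g (s b)"
  proof -
    have 1: "g (cproj p) = cproj (triple 8 (- 4) 0)"
    proof -
      have "(complex_of_real (sqrt 2))\<^sup>2 = 2" by (simp flip: of_real_power)
      then show ?thesis using g_cproj[OF p(1)] by (simp add: p_def g_lift_def power_mult_distrib)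
    qed
    have 2: "g (g (g (cproj p))) = cproj (triple 16384 16384 65536)"
      unfolding 1 by (simp add: g_cproj g_lift_def)
    have 3: "g (cproj (triple 4 1 3)) = cproj (triple 4 4 16)" by (simp add: g_cproj g_lift_def)
    have "triple 16384 16384 65536 = 4096 *s triple 4 4 16" by simp
    then have "cproj (triple 4 4 16) = cproj (triple 16384 16384 65536)"
      using cproj_eq_iff[of "triple 4 4 16" "triple 16384 16384 65536"]
      by (metis triple_eq_0_iff zero_neq_numeral)
    with 2 3 show ?thesis unfolding sD b0 b by simp
  qed
  obtain A' c' where A': "complex_linear A'" "A' b + c' = D (D (D b0))" "\<And>z. s (A' z + c') = g (s z)"
    using correspondence[OF img] by blast
  have "critical_point (s b) \<or> degenerate s b"
    using degenerate_semiconjugacy[OF A'(1,3), of b] deg unfolding A'(2) by blast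
  moreover have "\<not> critical_point (s b)"
    unfolding b by (simp add: critical_point_cproj critical_form_def)
  ultimately show ?thesis using that b by blast
qed

text \<open>Backward orbits of a degenerate point over \<open>[4 : 1 : 3]\<close> and its translates are degenerate and dense,
  while the nondegenerate points form a nonempty open set.\<close>

lemma inconsistent: False
proof -
  obtain a where a: "s a = cproj (triple 1 1 1)" using onto by blast
  obtain A c where A: "complex_linear A" "A a + c = a" and conj: "\<And>z. s (A z + c) = g (s z)"
    using correspondence[of a a] a g_fixed_point by auto
  have eig: "\<And>w r. w \<noteq> 0 \<Longrightarrow> A w = r *s w \<Longrightarrow> cmod r > 1"
    by (rule expanding_at_fixed_point[OF a A(2) A(1) conj])
  have det: "det2 A \<noteq> 0"
  proof
    assume "det2 A = 0"
    then obtain w where "w \<noteq> 0" "A w = 0 *s w" unfolding det2_eq_0_iff[OF A(1)] by auto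
    from eig[OF this] show False by simp
  qed
  have surj: "\<exists>z. A z = y" for y using det bij_iff_det2[OF A(1)] by (metis bij_pointE)
  define D where "D z = A z + c" for z
  have sD: "s ((D ^^ n) z) = (g ^^ n) (s z)" for n z
    by (induction n) (simp_all add: D_def conj)
  have D_diff: "(D ^^ n) z - (D ^^ n) u = (A ^^ n) (z - u)" for n z u
    by (induction n) (simp_all add: D_def complex_linear_diff[OF A(1), symmetric])
  have D_surj: "\<exists>z. (D ^^ n) z = y" for n y
  proof (induction n arbitrary: y)
    case (Suc n)
    obtain z where "A z = y - c" using surj by blast
    then have "D z = y" by (simp add: D_def)
    moreover obtain x where "(D ^^ n) x = z" using Suc by blast
    ultimately show ?case by auto
  qed simp
  obtain b where b: "s b = cproj (triple 4 1 3)" "degenerate s b"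
    using degenerate_over_413[OF A(1) det conj] by blast
  \<comment> \<open>an iterated preimage of this point is never critical, so degeneracy can be pulled back along \<open>D\<close>\<close>
  have off: "cproj (triple 4 1 3) \<notin> six_lines" by (simp add: cproj_in_six_lines line_form_def)
  have pull: "degenerate s u" if "degenerate s ((D ^^ n) u)" "s ((D ^^ n) u) = s b" for n u
    using that
  proof (induction n arbitrary: u)
    case (Suc n)
    have "degenerate s (D u)" using Suc by (simp add: funpow_swap1)
    then have "critical_point (s u) \<or> degenerate s u"
      using degenerate_semiconjugacy[OF A(1) conj, of u] unfolding D_def by blast
    moreover have "s b \<in> six_lines" if "critical_point (s u)"
      using iterate_g_critical_in_six_lines[OF that, of n] Suc.prems(2) sD[of "Suc n" u] by metis
    ultimately show ?case using off b(1) by metis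
  qed simp
  obtain R where R: "R > 0" "\<And>z. \<exists>l\<in>\<Lambda>. norm (z - l) \<le> R" using lattice_cocompact[OF lattice] by blast
  obtain z where z: "z \<in> {u. \<not> degenerate s u}" using somewhere_nondegenerate by blast
  then obtain \<epsilon> where \<epsilon>: "\<epsilon> > 0" "ball z \<epsilon> \<subseteq> {u. \<not> degenerate s u}"
    using open_nondegenerate open_contains_ball by blast
  have "\<exists>n. \<forall>v. norm ((A ^^ n) v) \<le> R \<longrightarrow> norm v < \<epsilon>"
    by (rule expanding_linear_map[OF A(1) _ \<epsilon>(1) R(1)]) (rule eig)
  then obtain n where n: "\<And>v. norm ((A ^^ n) v) \<le> R \<Longrightarrow> norm v < \<epsilon>" by blast
  obtain l where l: "l \<in> \<Lambda>" "norm ((D ^^ n) z - b - l) \<le> R" using R(2) by blast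
  obtain u where u: "(D ^^ n) u = b + l" using D_surj by blast
  have "norm ((A ^^ n) (z - u)) \<le> R"
    using l(2) D_diff[of n z u] u by (simp add: diff_diff_eq)
  then have "u \<in> ball z \<epsilon>" using n by (simp add: dist_norm)
  moreover have "degenerate s u"
    using pull[of n u] degenerate_periodic[OF l(1) b(2)] periodic[OF l(1), of b] u by simp
  ultimately show False using \<epsilon>(2) by blast
qed

end

section \<open>From Lattes examples to periodic semiconjugacies\<close>

lemma lattes_example_imp_toral_semiconjugacy:
  assumes "lattes_example g"
  obtains \<Lambda> s where "toral_semiconjugacy \<Lambda> s"
proof -
  obtain \<Lambda> :: "(complex^2) set" and D \<sigma> where L: "is_lattice \<Lambda>"
    and D: "holomorphic_map (complex_torus \<Lambda>) (complex_torus \<Lambda>) D"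
    and \<sigma>: "galois_covering (complex_torus \<Lambda>) cproj_space \<sigma>"
    and conj: "\<forall>a\<in>points (complex_torus \<Lambda>). \<sigma> (D a) = g (\<sigma> a)"
    using assms unfolding lattes_example_def by blast
  obtain G where hol: "holomorphic_map (complex_torus \<Lambda>) cproj_space \<sigma>"
    and onto: "\<sigma> ` points (complex_torus \<Lambda>) = points cproj_space"
    and G: "finite G" "\<forall>h\<in>G. holomorphic_map (complex_torus \<Lambda>) (complex_torus \<Lambda>) h"
    and orbit: "\<forall>a\<in>points (complex_torus \<Lambda>). \<forall>b\<in>points (complex_torus \<Lambda>). \<sigma> a = \<sigma> b \<longleftrightarrow> (\<exists>h\<in>G. b = h a)"
    using \<sigma> unfolding galois_covering_def by blast
  note pts = points_complex_torus[OF L]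
  define s where "s u = \<sigma> (coset \<Lambda> u)" for u
  have orbit': "s u = s v \<longleftrightarrow> (\<exists>h\<in>G. coset \<Lambda> v = h (coset \<Lambda> u))" for u v
    using orbit unfolding pts s_def by blast
  have onto': "\<exists>u. s u = q" for q
  proof -
    have "q \<in> \<sigma> ` points (complex_torus \<Lambda>)" unfolding onto points_cproj_space by simp
    then show ?thesis unfolding pts s_def by blast
  qed
  have "toral_semiconjugacy \<Lambda> s"
  proof
    show "is_lattice \<Lambda>" by (rule L)
    show "s (u + l) = s u" if "l \<in> \<Lambda>" for l u
      unfolding s_def using coset_eq_iff[OF L, of u "u + l"] that by simp
    show "\<exists>u. s u = q" for q by (rule onto')
    show "\<exists>S \<Phi>. homogeneous_lift s S \<Phi> \<and> u \<in> S" for u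
    proof (rule torus_local_expression[OF L hol, of u])
      fix V q S F
      assume h: "(V, q) \<in> (cproj_space :: (2, 2 cproj) atlas)" "open S" "u \<in> S" "holomorphic_vec_on F S"
        "\<And>v. v \<in> S \<Longrightarrow> \<sigma> (coset \<Lambda> v) = q (F v)"
      obtain i e where "q = (\<lambda>u. cproj (affine_lift i e u))" using h(1) unfolding cproj_space_eq by blast
      then have "homogeneous_lift s S (\<lambda>v. affine_lift i e (F v))"
        unfolding s_def using h by (intro homogeneous_lift_chart) auto
      with h(3) show ?thesis by blast
    qed
    show "countable {u. s u = q}" for q
    proof -
      obtain v where v: "s v = q" using onto' by blast
      have "{u. s u = q} \<subseteq> (\<Union>h\<in>G. {u. coset \<Lambda> u = h (coset \<Lambda> v)})"
        using orbit'[of v] unfolding v by auto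
      moreover have "countable {u. coset \<Lambda> u = h (coset \<Lambda> v)}" for h
      proof (cases "\<exists>w. coset \<Lambda> w = h (coset \<Lambda> v)")
        case True
        then obtain w where "coset \<Lambda> w = h (coset \<Lambda> v)" by blast
        then have "{u. coset \<Lambda> u = h (coset \<Lambda> v)} \<subseteq> coset \<Lambda> w" using coset_mem[OF L] by auto
        moreover have "countable (coset \<Lambda> w)" unfolding coset_def using countable_lattice[OF L] by blast
        ultimately show ?thesis by (rule countable_subset)
      next
        case False
        then have "{u. coset \<Lambda> u = h (coset \<Lambda> v)} = {}" by blast
        then show ?thesis by simp
      qed
      ultimately show ?thesis by (meson G(1) countable_UN countable_finite countable_subset)
    qed
    show "\<exists>A c. complex_linear A \<and> A u + c = v \<and> (\<forall>z. s (A z + c) = g (s z))" if sv: "s v = g (s u)" for u v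
    proof -
      obtain A c where A: "complex_linear A" "\<And>u. D (coset \<Lambda> u) = coset \<Lambda> (A u + c)"
        using torus_map_affine[OF L D] by blast
      have sA: "s (A z + c) = g (s z)" for z
        using conj A(2)[of z] unfolding pts s_def by (metis rangeI)
      have "s (A u + c) = s v" using sA sv by simp
      then obtain h where h: "h \<in> G" "coset \<Lambda> v = h (coset \<Lambda> (A u + c))" unfolding orbit' by blast
      obtain B d where B: "complex_linear B" "\<And>u. h (coset \<Lambda> u) = coset \<Lambda> (B u + d)"
        using torus_map_affine[OF L G(2)[rule_format, OF h(1)]] by blast
      have sB: "s (B z + d) = s z" for z using orbit'[of z "B z + d"] h(1) B(2)[of z] by auto
      \<comment> \<open>the wanted affine map lifts \<open>h \<circ> D\<close>; the lattice vector \<open>l\<close> makes it hit \<open>v\<close> exactly\<close>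
      define M where "M z = B (A z)" for z
      have M: "complex_linear M"
        unfolding M_def by (intro complex_linearI)
          (simp_all add: complex_linear_add[OF A(1)] complex_linear_add[OF B(1)]
            complex_linear_scale[OF A(1)] complex_linear_scale[OF B(1)])
      define l where "l = v - (B (A u + c) + d)"
      have l: "l \<in> \<Lambda>" using h(2) B(2) coset_eq_iff[OF L] unfolding l_def by metis
      define k where "k = B c + d + l"
      have "s (M z + k) = g (s z)" for z
      proof -
        have "M z + k = (B (A z + c) + d) + l"
          unfolding M_def k_def complex_linear_add[OF B(1)] by (simp add: algebra_simps)
        moreover have "coset \<Lambda> ((B (A z + c) + d) + l) = coset \<Lambda> (B (A z + c) + d)"
          using l lattice_uminus[OF L] coset_eq_iff[OF L] by simp
        ultimately have "s (M z + k) = s (B (A z + c) + d)" by (simp add: s_def)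
        then show ?thesis using sB sA by simp
      qed
      moreover have "M u + k = v"
        unfolding M_def k_def l_def complex_linear_add[OF B(1)] by (simp add: algebra_simps)
      ultimately show ?thesis using M by blast
    qed
  qed
  then show ?thesis by (rule that)
qed

theorem proposition1p3: "critically_finite g \<and> \<not> lattes_example g"
proof
  show "critically_finite g" by (rule critically_finite_g)
  show "\<not> lattes_example g"
  proof
    assume "lattes_example g"
    then obtain \<Lambda> s where "toral_semiconjugacy \<Lambda> s" by (rule lattes_example_imp_toral_semiconjugacy)
    then show False by (rule toral_semiconjugacy.inconsistent)
  qed
qed

end
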